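(* Let $G$ be a locally compact group and $U$ a strongly continuous unitary representation of $G$ on a Hilbert space $H$, and let $\alpha$ be the corresponding action of $G$ on the $C^*$-algebra $K(H)$ of compact operators, $\alpha_x(a)=U_xaU_x^*$. Then $\alpha$ is proper if and only if $U$ is square-integrable.
   Context: $G$ carries a fixed left Haar measure $dx$. Let $\mathcal B$ be the set of $\lambda\in L^\infty(G)$ with compact support and $0\le\lambda\le1$, directed pointwise. For $a\in K(H)$ put $p_\lambda(a)=\int_G\lambda(x)\alpha_x(a)\,dx$. An element $a\in K(H)^+$ is $\alpha$-proper if the net $(p_\lambda(a))_{\lambda\in\mathcal B}$ converges in the strict topology of $M(K(H))=B(H)$; $\mathcal P_\alpha$ is the linear span of the $\alpha$-proper elements, and $\alpha$ is proper if $\mathcal P_\alpha$ is dense in $K(H)$. For $\xi,\eta\in H$ let $c_{\xi\eta}(x)=\langle U_x\xi,\eta\rangle$. A vector $\xi\in H$ is $U$-bounded if there is a constant $k_\xi$ with $\|c_{\xi\eta}\|_{L^2(G)}\le k_\xi\|\eta\|$ for all $\eta\in H$ (equivalently $\|U_g\xi\|\le k_\xi\|g\|_2$ for all $g\in L^1\cap L^2(G)$, $U_g=\int g(x)U_x\,dx$). $U$ is square-integrable if the set $\mathcal B_U$ of $U$-bounded vectors is dense in $H$. *)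

theory Defs
  imports "HOL-Analysis.Analysis"
begin

text \<open>The group G is a type 'g; the group law (not assumed commutative) is written additively
  (class group_add). G is a Hausdorff topological group which is locally compact.\<close>

definition lc_group :: "'g::{t2_space, group_add} itself \<Rightarrow> bool" where
  "lc_group _ \<longleftrightarrow>
     continuous_on (UNIV :: ('g \<times> 'g) set) (\<lambda>p. fst p + snd p) \<and>
     continuous_on (UNIV :: 'g set) uminus \<and>
     (\<forall>x::'g. \<exists>V K. open V \<and> compact K \<and> x \<in> V \<and> V \<subseteq> K)"

definition left_haar :: "'g::{t2_space, group_add} measure \<Rightarrow> bool" where
  "left_haar \<mu> \<longleftrightarrow>
     sets \<mu> = sets borel \<and>
     (\<forall>g A. A \<in> sets borel \<longrightarrow> emeasure \<mu> ((\<lambda>x. g + x) ` A) = emeasure \<mu> A) \<and>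
     (\<forall>K. compact K \<longrightarrow> emeasure \<mu> K < \<infinity>) \<and>
     (\<forall>V. open V \<and> V \<noteq> {} \<longrightarrow> emeasure \<mu> V > 0) \<and>
     (\<forall>A \<in> sets borel. emeasure \<mu> A = (INF V\<in>{V. open V \<and> A \<subseteq> V}. emeasure \<mu> V)) \<and>
     (\<forall>V. open V \<longrightarrow> emeasure \<mu> V = (SUP K\<in>{K. compact K \<and> K \<subseteq> V}. emeasure \<mu> K))"

text \<open>A complex Hilbert space H is encoded as a real Hilbert space (real part of the complex
  inner product) together with the orthogonal map J = multiplication by i.\<close>

definition complex_structure :: "('h::{real_inner, complete_space} \<Rightarrow> 'h) \<Rightarrow> bool" where
  "complex_structure J \<longleftrightarrow> linear J \<and> (\<forall>v. J (J v) = - v) \<and> (\<forall>v w. J v \<bullet> J w = v \<bullet> w)"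

text \<open>complex scalar multiplication and the complex inner product (linear in the first slot)\<close>
definition csc :: "('h::real_inner \<Rightarrow> 'h) \<Rightarrow> complex \<Rightarrow> 'h \<Rightarrow> 'h" where
  "csc J c v = Re c *\<^sub>R v + Im c *\<^sub>R J v"

definition cip :: "('h::real_inner \<Rightarrow> 'h) \<Rightarrow> 'h \<Rightarrow> 'h \<Rightarrow> complex" where
  "cip J x y = Complex (x \<bullet> y) (x \<bullet> J y)"

definition bop :: "('h::real_inner \<Rightarrow> 'h) \<Rightarrow> ('h \<Rightarrow> 'h) \<Rightarrow> bool" where
  "bop J T \<longleftrightarrow> bounded_linear T \<and> (\<forall>v. T (J v) = J (T v))"

definition cpt :: "('h::real_inner \<Rightarrow> 'h) \<Rightarrow> ('h \<Rightarrow> 'h) \<Rightarrow> bool" where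
  "cpt J T \<longleftrightarrow> bop J T \<and> compact (closure (T ` cball 0 1))"

definition cpt_pos :: "('h::real_inner \<Rightarrow> 'h) \<Rightarrow> ('h \<Rightarrow> 'h) \<Rightarrow> bool" where
  "cpt_pos J a \<longleftrightarrow> cpt J a \<and> (\<forall>\<xi>. Im (cip J (a \<xi>) \<xi>) = 0 \<and> Re (cip J (a \<xi>) \<xi>) \<ge> 0)"

text \<open>Hilbert space adjoint (for complex-linear operators it coincides with the complex adjoint)\<close>
definition hadj :: "('h::real_inner \<Rightarrow> 'h) \<Rightarrow> 'h \<Rightarrow> 'h" where
  "hadj T = (THE S. \<forall>x y. T x \<bullet> y = x \<bullet> S y)"

definition unitary_op :: "('h::real_inner \<Rightarrow> 'h) \<Rightarrow> ('h \<Rightarrow> 'h) \<Rightarrow> bool" where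
  "unitary_op J V \<longleftrightarrow> bop J V \<and> surj V \<and> (\<forall>v. norm (V v) = norm v)"

definition sc_unitary_rep ::
  "('h::real_inner \<Rightarrow> 'h) \<Rightarrow> ('g::{topological_space, group_add} \<Rightarrow> 'h \<Rightarrow> 'h) \<Rightarrow> bool" where
  "sc_unitary_rep J U \<longleftrightarrow>
     (\<forall>x. unitary_op J (U x)) \<and>
     (\<forall>x y. U (x + y) = U x \<circ> U y) \<and> U 0 = id \<and>
     (\<forall>v. continuous_on UNIV (\<lambda>x. U x v))"

definition act :: "('g \<Rightarrow> 'h::real_inner \<Rightarrow> 'h) \<Rightarrow> 'g \<Rightarrow> ('h \<Rightarrow> 'h) \<Rightarrow> ('h \<Rightarrow> 'h)" where
  "act U x a = U x \<circ> a \<circ> hadj (U x)"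

definition Bset :: "'g::{topological_space, zero} measure \<Rightarrow> ('g \<Rightarrow> real) set" where
  "Bset \<mu> = {l. l \<in> borel_measurable \<mu> \<and> (\<forall>x. 0 \<le> l x \<and> l x \<le> 1) \<and>
                 (\<exists>K. compact K \<and> (\<forall>x. x \<notin> K \<longrightarrow> l x = 0))}"

text \<open>p_\<lambda>(a) = \<integral> \<lambda>(x) \<alpha>_x(a) dx, the operator-valued integral taken in the weak sense:
  the bounded operator T with \<langle>T\<xi>,\<eta>\<rangle> = \<integral> \<lambda>(x)\<langle>\<alpha>_x(a)\<xi>,\<eta>\<rangle> dx.\<close>
definition p_op :: "'g measure \<Rightarrow> ('h::real_inner \<Rightarrow> 'h) \<Rightarrow> ('g \<Rightarrow> 'h \<Rightarrow> 'h) \<Rightarrow>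
     ('g \<Rightarrow> real) \<Rightarrow> ('h \<Rightarrow> 'h) \<Rightarrow> ('h \<Rightarrow> 'h)" where
  "p_op \<mu> J U l a = (THE T. bop J T \<and>
      (\<forall>\<xi> \<eta>. T \<xi> \<bullet> \<eta> = (\<integral>x. l x * (act U x a \<xi> \<bullet> \<eta>) \<partial>\<mu>)))"

text \<open>a \<in> K(H)^+ is \<alpha>-proper: the net (p_\<lambda>(a))_{\<lambda>\<in>\<B>} converges strictly in M(K(H)) = B(H).\<close>
definition alpha_proper_elem :: "'g::{topological_space, group_add} measure \<Rightarrow> ('h::real_inner \<Rightarrow> 'h)
    \<Rightarrow> ('g \<Rightarrow> 'h \<Rightarrow> 'h) \<Rightarrow> ('h \<Rightarrow> 'h) \<Rightarrow> bool" where
  "alpha_proper_elem \<mu> J U a \<longleftrightarrow> cpt_pos J a \<and>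
     (\<exists>T. bop J T \<and>
        (\<forall>b. cpt J b \<longrightarrow> (\<forall>e>0. \<exists>l0\<in>Bset \<mu>. \<forall>l\<in>Bset \<mu>. l0 \<le> l \<longrightarrow>
            onorm ((\<lambda>v. p_op \<mu> J U l a v - T v) \<circ> b) < e \<and>
            onorm (b \<circ> (\<lambda>v. p_op \<mu> J U l a v - T v)) < e)))"

definition alpha_proper :: "'g::{topological_space, group_add} measure \<Rightarrow> ('h::real_inner \<Rightarrow> 'h)
    \<Rightarrow> ('g \<Rightarrow> 'h \<Rightarrow> 'h) \<Rightarrow> bool" where
  "alpha_proper \<mu> J U \<longleftrightarrow>
     (\<forall>a. cpt J a \<longrightarrow> (\<forall>e>0. \<exists>(n::nat) c b. (\<forall>i<n. alpha_proper_elem \<mu> J U (b i)) \<and>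
          onorm (\<lambda>v. a v - (\<Sum>i<n. csc J (c i) (b i v))) < e))"

definition U_bounded :: "'g measure \<Rightarrow> ('h::real_inner \<Rightarrow> 'h) \<Rightarrow> ('g \<Rightarrow> 'h \<Rightarrow> 'h) \<Rightarrow> 'h \<Rightarrow> bool" where
  "U_bounded \<mu> J U \<xi> \<longleftrightarrow> (\<exists>k. \<forall>\<eta>.
     (\<integral>\<^sup>+x. ennreal ((cmod (cip J (U x \<xi>) \<eta>))\<^sup>2) \<partial>\<mu>) \<le> ennreal ((k * norm \<eta>)\<^sup>2))"

definition square_integrable :: "'g measure \<Rightarrow> ('h::real_inner \<Rightarrow> 'h) \<Rightarrow> ('g \<Rightarrow> 'h \<Rightarrow> 'h) \<Rightarrow> bool" where
  "square_integrable \<mu> J U \<longleftrightarrow> closure {\<xi>. U_bounded \<mu> J U \<xi>} = UNIV"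

end

(*
If a is alpha-proper with strict limit T, then testing the net p_l(a) on the rank-one operator of v
gives int <alpha_x(a) v, v> dx <= <T v, v>.  Cauchy-Schwarz for the positive form of a then bounds
|<U_x a z, v>|^2 by a multiple of <alpha_x(a) v, v>, so every vector in the range of a is U-bounded;
approximating the projection onto a vector by proper elements shows that such vectors are dense.

Conversely, for a U-bounded vector z the rank-one operator of z is proper: the weak integral T of its
translates exists by Riesz, the differences T - p_l are positive and uniformly bounded, they tend to 0
strongly because |D v|^2 <= |D| <D v, v>, and uniform boundedness upgrades this to strict convergence.
Finite-rank approximation and polarization show that these operators span a dense subspace of K(H).

Haar measure is only inner regular on open sets, and the group need not be sigma-compact, so a
continuous integrand is integrated over {f > 1/n}, which has finite measure.
*)
theory Submission
  imports Defs
begin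

section \<open>Operators on a Hilbert space\<close>

text \<open>The space is handled as a real Hilbert space with a skew map \<open>J\<close>: Riesz,
  adjoints and Cauchy-Schwarz are real statements, and complex linearity is recovered from
  commutation with \<open>J\<close>. The passage from weak to strict convergence rests on one
  constant. For U-bounded z with bound C, T - p_l is the weak integral with weight 1 - l, which
  again takes values in [0,1]; so the estimate that bounds T by C bounds every difference by the
  same C. Positivity then lets the scalar <(T - p_l) v, v> control the vector (T - p_l) v, and this
  scalar is at most the integral of |<U_x z, v>|^2 over the complement of any compact set on which l
  is 1. That compact set depends on v; compactness of the test operator b reduces the unit ball to
  finitely many vectors, and finitely many compact sets have a compact union. Continuity of the
  coefficients enters through the superlevel sets: they are open, hence accessible to inner
  regularity by compact sets.\<close>

theorem riesz_representation:
  fixes f :: "'h::{real_inner, complete_space} \<Rightarrow> real"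
  assumes "bounded_linear f"
  shows "\<exists>u. \<forall>v. f v = u \<bullet> v"
proof -
  interpret f: bounded_linear f by fact
  \<comment> \<open>The representing vector minimises the quadratic functional \<open>q\<close>.\<close>
  define q where "q = (\<lambda>v. v \<bullet> v - 2 * f v)"
  obtain c where c: "\<And>v. \<bar>f v\<bar> \<le> norm v * c" "c > 0"
    using f.pos_bounded by auto
  have q_below: "- c\<^sup>2 \<le> q v" for v
  proof -
    have "0 \<le> (norm v - c)\<^sup>2" by simp
    moreover have "f v \<le> norm v * c" using c(1)[of v] by linarith
    ultimately show ?thesis
      unfolding q_def by (simp add: power2_eq_square algebra_simps dot_square_norm)
  qed
  then have bdd: "bdd_below (range q)" by (intro bdd_belowI2)
  define m where "m = Inf (range q)"
  have m_le: "m \<le> q v" for v unfolding m_def by (rule cInf_lower[OF _ bdd]) simp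
  have par: "(norm (v - w))\<^sup>2 \<le> 2 * (q v - m) + 2 * (q w - m)" for v w
  proof -
    have "(norm (v - w))\<^sup>2 = 2 * q v + 2 * q w - 4 * q ((1/2) *\<^sub>R (v + w))"
      unfolding q_def power2_norm_eq_inner
      by (simp add: f.add f.scaleR inner_add inner_diff inner_commute algebra_simps)
    with m_le[of "(1/2) *\<^sub>R (v + w)"] show ?thesis by simp
  qed
  have "\<exists>v. q v < m + 1 / real (Suc n)" for n
  proof -
    have "Inf (range q) < m + 1 / real (Suc n)" by (simp add: m_def)
    then show ?thesis using cInf_lessD[of "range q"] by blast
  qed
  then obtain X where X: "\<And>n. q (X n) < m + 1 / real (Suc n)" by metis
  have "Cauchy X"
  proof (rule metric_CauchyI)
    fix e :: real assume "e > 0"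
    obtain N where "4 / e\<^sup>2 < real N" using reals_Archimedean2 by blast
    then have N: "4 / e\<^sup>2 < real (Suc N)" by simp
    have small: "q (X n) - m < e\<^sup>2 / 4" if "n \<ge> N" for n
    proof -
      have "1 / real (Suc n) \<le> 1 / real (Suc N)" using that by (simp add: frac_le)
      also have "\<dots> < e\<^sup>2 / 4" using N \<open>e > 0\<close> by (simp add: field_simps)
      finally show ?thesis using X[of n] by linarith
    qed
    have "dist (X i) (X j) < e" if "i \<ge> N" "j \<ge> N" for i j
    proof -
      have "(norm (X i - X j))\<^sup>2 < e\<^sup>2"
        by (rule le_less_trans[OF par]) (use small[OF that(1)] small[OF that(2)] in simp)
      then show ?thesis using \<open>e > 0\<close> by (simp add: dist_norm power2_less_imp_less)
    qed
    then show "\<exists>M. \<forall>i\<ge>M. \<forall>j\<ge>M. dist (X i) (X j) < e" by blast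
  qed
  then obtain u where u: "X \<longlonglongrightarrow> u" using Cauchy_convergent convergent_def by blast
  have "(\<lambda>n. q (X n)) \<longlonglongrightarrow> q u"
    unfolding q_def by (intro tendsto_intros f.tendsto u)
  moreover have "(\<lambda>n. m + 1 / real (Suc n)) \<longlonglongrightarrow> m + 0"
    by (intro tendsto_intros) (use LIMSEQ_inverse_real_of_nat in \<open>simp add: inverse_eq_divide\<close>)
  ultimately have "q u \<le> m + 0"
    by (rule LIMSEQ_le) (use X in \<open>auto intro: less_imp_le\<close>)
  then have qu: "q u \<le> q v" for v using m_le[of v] by simp
  have "f v = u \<bullet> v" for v
  proof (rule ccontr)
    define d where "d = u \<bullet> v - f v"
    assume "f v \<noteq> u \<bullet> v"
    then have d: "d \<noteq> 0" by (simp add: d_def)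
    \<comment> \<open>The optimal step along \<open>v\<close> would be
      \<open>d / (v \<bullet> v)\<close>; adding 1 to the denominator covers \<open>v = 0\<close>
      and still decreases \<open>q\<close>.\<close>
    define s where "s = d / (v \<bullet> v + 1)"
    have pos: "v \<bullet> v + 1 > 0" using inner_ge_zero[of v] by linarith
    have "q (u - s *\<^sub>R v) = q u - 2 * s * d + s\<^sup>2 * (v \<bullet> v)"
      unfolding q_def d_def by (simp add: f.diff f.scaleR inner_diff inner_commute algebra_simps power2_eq_square)
    with qu[of "u - s *\<^sub>R v"] have "2 * s * d \<le> s\<^sup>2 * (v \<bullet> v)" by simp
    also have "\<dots> \<le> s\<^sup>2 * (v \<bullet> v + 1)" by (simp add: mult_left_mono)
    also have "\<dots> = s * d" using pos by (simp add: s_def power2_eq_square)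
    finally have "s * d \<le> 0" by linarith
    moreover have "s * d = d\<^sup>2 / (v \<bullet> v + 1)" by (simp add: s_def power2_eq_square)
    moreover have "d\<^sup>2 / (v \<bullet> v + 1) > 0" using d pos by simp
    ultimately show False by simp
  qed
  then show ?thesis by blast
qed

lemma bounded_form_operator:
  fixes B :: "'h::{real_inner, complete_space} \<Rightarrow> 'h \<Rightarrow> real"
  assumes "bounded_bilinear B"
  shows "\<exists>T. bounded_linear T \<and> (\<forall>v w. T v \<bullet> w = B v w)"
proof -
  interpret B: bounded_bilinear B by fact
  have "\<exists>u. \<forall>w. B v w = u \<bullet> w" for v
    by (rule riesz_representation[OF B.bounded_linear_right])
  then obtain T where T: "\<And>v w. B v w = T v \<bullet> w" by metis
  obtain c where c: "\<And>v w. norm (B v w) \<le> norm v * norm w * c" "c > 0"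
    using B.pos_bounded by auto
  have "bounded_linear T"
  proof (rule bounded_linear_intro)
    show "T (x + y) = T x + T y" for x y
      by (rule vector_eq_rdot[THEN iffD1]) (simp add: T[symmetric] inner_add_left B.add_left)
    show "T (r *\<^sub>R x) = r *\<^sub>R T x" for r x
      by (rule vector_eq_rdot[THEN iffD1]) (simp add: T[symmetric] B.scaleR_left)
    show "norm (T x) \<le> norm x * c" for x
    proof (cases "T x = 0")
      case False
      have "norm (T x) * norm (T x) \<le> norm (T x) * (norm x * c)"
        using c(1)[of x "T x"] by (simp add: T norm_mult dot_square_norm power2_eq_square mult_ac)
      with False show ?thesis by simp
    qed (use c in simp)
  qed
  with T show ?thesis by auto
qed

lemma hilbert_adjoint:
  fixes T :: "'h::{real_inner, complete_space} \<Rightarrow> 'h"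
  assumes "bounded_linear T"
  shows "\<exists>S. bounded_linear S \<and> (\<forall>v w. S v \<bullet> w = v \<bullet> T w)"
  by (rule bounded_form_operator)
     (rule bounded_bilinear.comp[OF bounded_bilinear_inner bounded_linear_ident assms])

lemma cauchy_schwarz_psd_form:
  fixes a :: "'h::real_inner \<Rightarrow> 'h"
  assumes "linear a" and sym: "\<And>v w. a v \<bullet> w = a w \<bullet> v" and pos: "\<And>v. a v \<bullet> v \<ge> 0"
  shows "(a v \<bullet> w)\<^sup>2 \<le> (a v \<bullet> v) * (a w \<bullet> w)"
proof -
  interpret a: linear a by fact
  have exp: "a (v - s *\<^sub>R w) \<bullet> (v - s *\<^sub>R w) = a v \<bullet> v - 2 * s * (a v \<bullet> w) + s\<^sup>2 * (a w \<bullet> w)" for s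
    by (simp add: a.diff a.scale inner_diff sym[of w v] algebra_simps power2_eq_square)
  show ?thesis
  proof (cases "a w \<bullet> w = 0")
    case True
    have "a v \<bullet> w = 0"
    proof (rule ccontr)
      assume n: "a v \<bullet> w \<noteq> 0"
      \<comment> \<open>With leading coefficient 0 the polynomial is affine in s, and this s gives
        it the value -1.\<close>
      define s where "s = (a v \<bullet> v + 1) / (2 * (a v \<bullet> w))"
      have "2 * s * (a v \<bullet> w) = a v \<bullet> v + 1" using n by (simp add: s_def)
      then show False using exp[of s] pos[of "v - s *\<^sub>R w"] True by simp
    qed
    with True show ?thesis by simp
  next
    case False
    with pos[of w] have p: "a w \<bullet> w > 0" by simp
    define s where "s = (a v \<bullet> w) / (a w \<bullet> w)"
    have "a v \<bullet> v - 2 * s * (a v \<bullet> w) + s\<^sup>2 * (a w \<bullet> w) = a v \<bullet> v - (a v \<bullet> w)\<^sup>2 / (a w \<bullet> w)"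
      using p by (simp add: s_def power2_eq_square field_simps)
    with exp[of s] pos[of "v - s *\<^sub>R w"] have "(a v \<bullet> w)\<^sup>2 / (a w \<bullet> w) \<le> a v \<bullet> v" by simp
    with p show ?thesis by (simp add: field_simps)
  qed
qed

text \<open>Cauchy-Schwarz for the form with \<open>w = a v\<close>, divided by the square of
  \<open>norm (a v)\<close>. It turns convergence of quadratic forms of uniformly bounded positive
  operators into strong convergence.\<close>

lemma psd_norm_square_le:
  fixes a :: "'h::real_inner \<Rightarrow> 'h"
  assumes "linear a" and sym: "\<And>v w. a v \<bullet> w = a w \<bullet> v" and pos: "\<And>v. a v \<bullet> v \<ge> 0"
    and bound: "\<And>v. norm (a v) \<le> C * norm v"
  shows "(norm (a v))\<^sup>2 \<le> C * (a v \<bullet> v)"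
proof (cases "a v = 0")
  case False
  then have n: "(norm (a v))\<^sup>2 > 0" by simp
  have "(norm (a v))\<^sup>2 * (norm (a v))\<^sup>2 = (a v \<bullet> a v)\<^sup>2"
    by (simp only: power2_norm_eq_inner) (simp only: power2_eq_square)
  also have "\<dots> \<le> (a v \<bullet> v) * (a (a v) \<bullet> a v)"
    by (rule cauchy_schwarz_psd_form[OF assms(1-3)])
  also have "\<dots> \<le> (a v \<bullet> v) * (C * (norm (a v))\<^sup>2)"
  proof (rule mult_left_mono[OF _ pos])
    have "a (a v) \<bullet> a v \<le> norm (a (a v)) * norm (a v)" by (rule norm_cauchy_schwarz)
    also have "\<dots> \<le> C * norm (a v) * norm (a v)" by (intro mult_right_mono bound) simp
    finally show "a (a v) \<bullet> a v \<le> C * (norm (a v))\<^sup>2" by (simp add: power2_eq_square mult_ac)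
  qed
  finally have "(norm (a v))\<^sup>2 * (norm (a v))\<^sup>2 \<le> (C * (a v \<bullet> v)) * (norm (a v))\<^sup>2"
    by (simp only: mult_ac)
  with n show ?thesis by (simp only: mult_le_cancel_right_pos)
qed (use assms(1) pos bound in simp)

section \<open>The complex structure\<close>

locale complex_hilbert =
  fixes J :: "'h::{real_inner, complete_space} \<Rightarrow> 'h"
  assumes complex_structure: "complex_structure J"
begin

lemma linear_J: "linear J" and J_J [simp]: "J (J v) = - v" and J_J_inner [simp]: "J v \<bullet> J w = v \<bullet> w"
  using complex_structure by (auto simp: complex_structure_def)

lemma J_add: "J (v + w) = J v + J w" and J_diff: "J (v - w) = J v - J w"
  and J_scaleR: "J (r *\<^sub>R v) = r *\<^sub>R J v" and J_zero [simp]: "J 0 = 0" and J_minus: "J (- v) = - J v"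
  using linear_J by (simp_all add: linear_add linear_diff linear_scale linear_0 linear_neg)

lemma inner_J_left: "J v \<bullet> w = - (v \<bullet> J w)"
  using J_J_inner[of v "J w"] by simp

lemma inner_J_self [simp]: "v \<bullet> J v = 0" "J v \<bullet> v = 0"
  using inner_J_left[of v v] by (simp_all add: inner_commute)

lemma csc_add_right: "csc J c (v + w) = csc J c v + csc J c w"
  and csc_diff_right: "csc J c (v - w) = csc J c v - csc J c w"
  and csc_scaleR_right: "csc J c (r *\<^sub>R v) = r *\<^sub>R csc J c v"
  and csc_add_left: "csc J (c + d) v = csc J c v + csc J d v"
  and csc_diff_left: "csc J (c - d) v = csc J c v - csc J d v"
  and csc_scaleR_left: "csc J (r *\<^sub>R c) v = r *\<^sub>R csc J c v"
  and csc_J: "csc J c (J v) = J (csc J c v)"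
  and csc_of_real: "csc J (complex_of_real r) v = r *\<^sub>R v"
  and csc_csc: "csc J c (csc J d v) = csc J (c * d) v"
  by (simp_all add: csc_def algebra_simps J_add J_diff J_scaleR J_minus)

lemma csc_i_mult: "csc J (\<i> * c) v = J (csc J c v)"
  by (simp add: csc_def J_add J_scaleR J_diff)

lemma norm_csc: "norm (csc J c v) = cmod c * norm v"
proof -
  have "(norm (csc J c v))\<^sup>2 = (cmod c * norm v)\<^sup>2"
    by (simp only: csc_def power2_norm_eq_inner[where 'a = 'h] power_mult_distrib cmod_power2)
       (simp add: inner_add power2_eq_square distrib_left mult_ac)
  then show ?thesis by (simp add: power2_eq_iff_nonneg)
qed

lemma cip_add_left: "cip J (v + w) u = cip J v u + cip J w u"
  and cip_add_right: "cip J u (v + w) = cip J u v + cip J u w"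
  and cip_diff_right: "cip J u (v - w) = cip J u v - cip J u w"
  and cip_scaleR_left: "cip J (r *\<^sub>R v) u = r *\<^sub>R cip J v u"
  and cip_J_left: "cip J (J v) u = \<i> * cip J v u"
  and cip_J_right: "cip J u (J v) = - \<i> * cip J u v"
  by (simp_all add: cip_def complex_eq_iff inner_add inner_diff J_add J_diff J_scaleR inner_J_left)

lemma cnj_cip: "cnj (cip J u v) = cip J v u"
  using inner_J_left[of u v] by (simp add: cip_def complex_eq_iff inner_commute)

lemma cip_csc_left: "cip J (csc J c v) u = c * cip J v u"
  by (simp add: csc_def cip_add_left cip_scaleR_left cip_J_left)
     (simp add: complex_eq_iff)

lemma cip_csc_right: "cip J u (csc J c v) = cnj c * cip J u v"
  by (metis cip_csc_left cnj_cip complex_cnj_mult)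

lemma Re_cip [simp]: "Re (cip J v w) = v \<bullet> w"
  by (simp add: cip_def)

lemma cip_self: "cip J v v = complex_of_real ((norm v)\<^sup>2)"
  by (simp add: cip_def complex_eq_iff power2_norm_eq_inner)

lemma cmod_cip_commute: "cmod (cip J v w) = cmod (cip J w v)"
  by (metis cnj_cip complex_mod_cnj)

text \<open>Multiplying \<open>w\<close> by the scalar \<open>cip J v w\<close> makes the product
  real and equal to the squared modulus, so the real Cauchy-Schwarz inequality applies.\<close>

lemma cmod_cip_le: "cmod (cip J v w) \<le> norm v * norm w"
proof (cases "cip J v w = 0")
  case False
  let ?z = "cip J v w"
  have "cip J v (csc J ?z w) = complex_of_real ((cmod ?z)\<^sup>2)"
    by (simp only: cip_csc_right) (metis complex_norm_square mult.commute)
  then have "(cmod ?z)\<^sup>2 = v \<bullet> csc J ?z w" by (metis Re_cip Re_complex_of_real)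
  also have "\<dots> \<le> norm v * norm (csc J ?z w)" by (rule norm_cauchy_schwarz)
  also have "\<dots> = cmod ?z * (norm v * norm w)" by (simp add: norm_csc)
  finally show ?thesis using False by (simp add: power2_eq_square)
qed simp

lemma bopD: "bop J T \<Longrightarrow> bounded_linear T" "bop J T \<Longrightarrow> T (J v) = J (T v)"
  by (simp_all add: bop_def)

lemma bop_csc: "bop J T \<Longrightarrow> T (csc J c v) = csc J c (T v)"
  by (simp add: csc_def bop_def linear_simps)

lemma bop_diff: "bop J S \<Longrightarrow> bop J T \<Longrightarrow> bop J (\<lambda>v. S v - T v)"
  by (simp add: bop_def bounded_linear_sub J_diff)

lemma bop_compose: "bop J S \<Longrightarrow> bop J T \<Longrightarrow> bop J (S \<circ> T)"
  unfolding bop_def o_def by (auto intro: bounded_linear_compose)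

lemma bounded_linear_csc: "bounded_linear (csc J c)"
  by (rule bounded_linear_intro[where K = "cmod c"])
     (simp_all add: csc_add_right csc_scaleR_right norm_csc)

lemma bop_csc_bop: "bop J T \<Longrightarrow> bop J (\<lambda>v. csc J c (T v))"
  by (simp add: bop_def csc_J bounded_linear_compose[OF bounded_linear_csc])

text \<open>The real adjoint commutes with \<open>J\<close> because \<open>T\<close> does and
  \<open>J\<close> is skew; hence it is also the complex adjoint.\<close>

lemma bop_adjoint:
  assumes "bop J T"
  shows "\<exists>S. bop J S \<and> (\<forall>v w. S v \<bullet> w = v \<bullet> T w) \<and> (\<forall>v w. cip J (S v) w = cip J v (T w))"
proof -
  obtain S where S: "bounded_linear S" "\<And>v w. S v \<bullet> w = v \<bullet> T w"
    using hilbert_adjoint[OF bopD(1)[OF assms]] by blast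
  have "S (J v) = J (S v)" for v
    by (rule vector_eq_rdot[THEN iffD1]) (simp add: S(2) inner_J_left bopD(2)[OF assms, symmetric])
  then have "bop J S" using S(1) by (simp add: bop_def)
  moreover have "cip J (S v) w = cip J v (T w)" for v w
    by (simp add: cip_def S(2) bopD(2)[OF assms])
  ultimately show ?thesis using S(2) by blast
qed

text \<open>Self-adjointness comes from polarizing the vanishing imaginary part
  \<open>a u \<bullet> J u = 0\<close> and then substituting \<open>J w\<close> for u.\<close>

lemma cpt_posD:
  assumes "cpt_pos J a"
  shows "cpt J a" and "bop J a" and "a v \<bullet> v \<ge> 0" and "a v \<bullet> w = a w \<bullet> v"
proof -
  show "cpt J a" and bop: "bop J a" and "a v \<bullet> v \<ge> 0"
    using assms by (auto simp: cpt_pos_def cpt_def)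
  have zero: "a u \<bullet> J u = 0" for u using assms by (simp add: cpt_pos_def cip_def)
  have "a v \<bullet> J u + a u \<bullet> J v = 0" for u
    using zero[of "v + u"] zero[of v] zero[of u] bopD(1)[OF bop]
    by (simp add: linear_simps J_add inner_add)
  from this[of "J w"] show "a v \<bullet> w = a w \<bullet> v"
    using bop by (simp add: bop_def)
qed

text \<open>The real Cauchy-Schwarz inequality is applied to the real part and, with
  \<open>J w\<close> in place of \<open>w\<close>, to the imaginary part; this is the origin of the
  factor 2.\<close>

lemma cpt_pos_cauchy_schwarz:
  assumes "cpt_pos J a"
  shows "(cmod (cip J (a v) w))\<^sup>2 \<le> 2 * (a v \<bullet> v) * (a w \<bullet> w)"
proof -
  note a = cpt_posD[OF assms]
  have lin: "linear a" using bopD(1)[OF a(2)] by (rule bounded_linear.linear)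
  note cs = cauchy_schwarz_psd_form[OF lin a(4) a(3)]
  have "(cmod (cip J (a v) w))\<^sup>2 = (a v \<bullet> w)\<^sup>2 + (a v \<bullet> J w)\<^sup>2"
    by (simp add: cip_def cmod_power2)
  with cs[of v w] cs[of v "J w"] show ?thesis by (simp add: bopD(2)[OF a(2)])
qed

subsection \<open>Rank-one operators\<close>

definition rank_one :: "'h \<Rightarrow> 'h \<Rightarrow> 'h \<Rightarrow> 'h" where
  "rank_one x y v = csc J (cip J v y) x"

lemma norm_rank_one_le: "norm (rank_one x y v) \<le> norm x * norm y * norm v"
proof -
  have "cmod (cip J v y) * norm x \<le> (norm v * norm y) * norm x"
    by (intro mult_right_mono cmod_cip_le) simp
  then show ?thesis by (simp add: rank_one_def norm_csc mult_ac)
qed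

lemma bop_rank_one: "bop J (rank_one x y)"
  unfolding bop_def
proof
  show "bounded_linear (rank_one x y)"
    by (rule bounded_linear_intro[where K = "norm x * norm y"])
       (use norm_rank_one_le[of x y] in \<open>simp_all add: rank_one_def cip_add_left csc_add_left
          cip_scaleR_left csc_scaleR_left mult.commute\<close>)
  show "\<forall>v. rank_one x y (J v) = J (rank_one x y v)"
    by (simp add: rank_one_def cip_J_left csc_i_mult)
qed

lemma cpt_rank_one: "cpt J (rank_one x y)"
  unfolding cpt_def
proof
  let ?K = "(\<lambda>c. csc J c x) ` cball 0 (norm y)"
  have "compact ?K"
    unfolding csc_def by (intro compact_continuous_image continuous_intros compact_cball)
  moreover have "rank_one x y ` cball 0 1 \<subseteq> ?K"
  proof
    fix z assume "z \<in> rank_one x y ` cball 0 1"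
    then obtain v where v: "norm v \<le> 1" "z = csc J (cip J v y) x" by (auto simp: rank_one_def)
    have "cmod (cip J v y) \<le> norm v * norm y" by (rule cmod_cip_le)
    also have "\<dots> \<le> 1 * norm y" using v(1) by (intro mult_right_mono) auto
    finally show "z \<in> ?K" using v(2) by auto
  qed
  ultimately show "compact (closure (rank_one x y ` cball 0 1))"
    by (metis closed_closure closure_minimal compact_Int_closed compact_imp_closed inf.absorb2)
qed (rule bop_rank_one)

lemma cip_rank_one_self: "cip J (rank_one x x v) v = complex_of_real ((cmod (cip J x v))\<^sup>2)"
  by (simp only: rank_one_def cip_csc_left cnj_cip[of x v, symmetric]) (metis complex_norm_square mult.commute)

lemma rank_one_self: "rank_one v v v = (norm v)\<^sup>2 *\<^sub>R v"
  by (simp only: rank_one_def cip_self csc_of_real)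

lemma cpt_pos_rank_one: "cpt_pos J (rank_one x x)"
  by (simp add: cpt_pos_def cpt_rank_one cip_rank_one_self del: Re_cip)

lemma rank_one_polarization:
  "rank_one x y v = csc J (1/4) (rank_one (x + y) (x + y) v)
     + csc J (-1/4) (rank_one (x - y) (x - y) v)
     + csc J (\<i>/4) (rank_one (x + J y) (x + J y) v)
     + csc J (-\<i>/4) (rank_one (x - J y) (x - J y) v)"
proof -
  \<comment> \<open>Here p and q stand for the products of \<open>v\<close> with \<open>x\<close>
    and \<open>y\<close>. Collecting coefficients leaves q in front of \<open>x\<close> and 0 in
    front of \<open>y\<close> for the four polarization weights.\<close>
  have comb: "csc J (a * (p + q)) (x + y) + csc J (b * (p - q)) (x - y)
      + csc J (c * (p - \<i> * q)) (x + J y) + csc J (d * (p + \<i> * q)) (x - J y)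
    = csc J (a * (p + q) + b * (p - q) + c * (p - \<i> * q) + d * (p + \<i> * q)) x
      + csc J (a * (p + q) - b * (p - q) + \<i> * (c * (p - \<i> * q)) - \<i> * (d * (p + \<i> * q))) y"
    for a b c d p q
    by (simp only: csc_add_right csc_diff_right csc_J csc_i_mult csc_add_left csc_diff_left) simp
  show ?thesis
    unfolding rank_one_def csc_csc cip_add_right cip_diff_right cip_J_right
    using comb[of "1/4" "cip J v x" "cip J v y" "-1/4" "\<i>/4" "-\<i>/4"]
    by (simp add: field_simps csc_def[of J 0])
qed

subsection \<open>Approximation of compact operators\<close>

lemma norm_le_of_unit_ball:
  fixes D :: "'h \<Rightarrow> 'h"
  assumes "linear D" and "\<And>v. norm v \<le> 1 \<Longrightarrow> norm (D v) \<le> e"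
  shows "norm (D v) \<le> e * norm v"
proof (cases "v = 0")
  case False
  have "norm (D ((1 / norm v) *\<^sub>R v)) \<le> e" using False by (intro assms(2)) simp
  then show ?thesis using False by (simp add: linear_scale[OF assms(1)] field_simps)
qed (simp add: linear_0[OF assms(1)])

lemma cpt_finite_net:
  assumes "cpt J a" and "e > 0"
  shows "\<exists>Y. finite Y \<and> (\<forall>v. norm v \<le> 1 \<longrightarrow> (\<exists>y\<in>Y. norm (a v - y) < e))"
proof -
  obtain Y where Y: "finite Y" "closure (a ` cball 0 1) \<subseteq> (\<Union>y\<in>Y. ball y e)"
    using assms unfolding cpt_def compact_eq_totally_bounded by blast
  have "\<exists>y\<in>Y. norm (a v - y) < e" if "norm v \<le> 1" for v
  proof -
    have "a v \<in> closure (a ` cball 0 1)" using that by (intro closure_subset[THEN subsetD]) simp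
    with Y(2) show ?thesis by (force simp: dist_norm norm_minus_commute)
  qed
  with Y(1) show ?thesis by blast
qed

text \<open>Gram-Schmidt: the sum is the orthogonal projection onto the span of an orthonormal
  family. The induction carries only idempotence, since any such sum is self-adjoint, and a
  self-adjoint idempotent is a contraction.\<close>

lemma finite_rank_projection:
  assumes "finite Y"
  shows "\<exists>(m::nat) e. (\<forall>y\<in>Y. (\<Sum>i<m. rank_one (e i) (e i) y) = y) \<and>
    (\<forall>v. norm (\<Sum>i<m. rank_one (e i) (e i) v) \<le> norm v)"
proof -
  define P where "P = (\<lambda>(m::nat) e v. \<Sum>i<m. rank_one (e i) (e i) v)"
  have bopP: "bop J (P m e)" for m e
  proof (induction m)
    case 0 then show ?case by (simp add: P_def bop_def)
  next
    case (Suc m) then show ?case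
      using bop_rank_one[of "e m" "e m"]
      by (simp add: P_def bop_def bounded_linear_add J_add)
  qed
  have Psym: "cip J (P m e v) w = cip J v (P m e w)" for m e v w
  proof (induction m)
    case 0 then show ?case by (simp add: P_def cip_def)
  next
    case (Suc m) then show ?case
      by (simp add: P_def cip_add_left cip_add_right rank_one_def cip_csc_left cip_csc_right cnj_cip)
  qed
  have "\<exists>m e. (\<forall>y\<in>Y. P m e y = y) \<and> (\<forall>v. P m e (P m e v) = P m e v)"
    using assms
  proof (induction Y rule: finite_induct)
    case empty
    have "P 0 e v = 0" for e v by (simp add: P_def)
    then show ?case by (intro exI[of _ 0]) simp
  next
    case (insert y Y)
    then obtain m e where fixed: "\<And>u. u \<in> Y \<Longrightarrow> P m e u = u"
      and idem: "\<And>v. P m e (P m e v) = P m e v" by blast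
    define z where "z = y - P m e y"
    interpret P: bounded_linear "P m e" by (rule bopD(1)[OF bopP])
    show ?case
    proof (cases "z = 0")
      case True
      then show ?thesis using fixed idem unfolding z_def by (intro exI[of _ m] exI[of _ e]) auto
    next
      case False
      define u where "u = (1 / norm z) *\<^sub>R z"
      have Pu: "P m e u = 0" by (simp add: u_def z_def P.scaleR P.diff idem)
      have uu: "cip J u u = 1" using False by (simp add: cip_self u_def)
      \<comment> \<open>The normalised residual \<open>u\<close> is killed by the self-adjoint
        \<open>P m e\<close>, hence orthogonal to its range.\<close>
      have orth: "cip J (P m e v) u = 0" for v
        using Psym[of m e v u] by (simp add: Pu cip_def complex_eq_iff)
      \<comment> \<open>Overwriting index m leaves \<open>P m\<close> unchanged, as it only reads
        indices below m.\<close>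
      define e' where "e' = e(m := u)"
      have "P m e' = P m e" unfolding P_def e'_def by (intro ext sum.cong) auto
      then have P': "P (Suc m) e' v = P m e v + csc J (cip J v u) u" for v
        by (simp add: P_def e'_def rank_one_def)
      have zero: "csc J 0 u = 0" by (simp add: csc_def)
      have "P (Suc m) e' w = w" if "w \<in> Y" for w
        using orth[of w] fixed[OF that] by (simp add: P' zero)
      moreover have "P (Suc m) e' y = y"
      proof -
        have "cip J y u = cip J (P m e y + norm z *\<^sub>R u) u"
          using False by (simp add: u_def z_def)
        also have "\<dots> = complex_of_real (norm z)"
          by (simp add: cip_add_left cip_scaleR_left orth uu scaleR_conv_of_real)
        finally show ?thesis using False by (simp add: P' csc_of_real u_def) (simp add: z_def)
      qed
      moreover have "P (Suc m) e' (P (Suc m) e' v) = P (Suc m) e' v" for v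
        by (simp add: P' P.add idem bop_csc[OF bopP] Pu cip_add_left orth cip_csc_left uu)
           (simp add: csc_def)
      ultimately show ?thesis by (intro exI[of _ "Suc m"] exI[of _ e']) auto
    qed
  qed
  then obtain m e where me: "\<forall>y\<in>Y. P m e y = y" "\<And>v. P m e (P m e v) = P m e v" by blast
  have "norm (P m e v) \<le> norm v" for v
  proof (cases "P m e v = 0")
    case False
    have "P m e v \<bullet> P m e v = v \<bullet> P m e v"
      using Psym[of m e v "P m e v"] by (simp add: cip_def me(2))
    then have "norm (P m e v) * norm (P m e v) \<le> norm v * norm (P m e v)"
      using norm_cauchy_schwarz[of v "P m e v"] by (simp add: dot_square_norm power2_eq_square)
    with False show ?thesis by simp
  qed simp
  with me(1) show ?thesis unfolding P_def by blast
qed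

text \<open>Compress \<open>a\<close> by the projection P fixing a finite net of the image of the
  unit ball. P fixes the net and contracts, so the net error at most doubles; the adjoint of
  \<open>a\<close> rewrites \<open>P \<circ> a\<close> as a sum of rank-one operators.\<close>

lemma cpt_finite_rank_approx:
  assumes "cpt J a" and "e > 0"
  shows "\<exists>(m::nat) x y. \<forall>v. norm (a v - (\<Sum>i<m. rank_one (x i) (y i) v)) \<le> e * norm v"
proof -
  have bop: "bop J a" using assms(1) by (simp add: cpt_def)
  interpret a: bounded_linear a by (rule bopD(1)[OF bop])
  obtain Y where Y: "finite Y" "\<And>v. norm v \<le> 1 \<Longrightarrow> \<exists>y\<in>Y. norm (a v - y) < e / 2"
    using cpt_finite_net[OF assms(1), of "e / 2"] assms(2) by auto
  from finite_rank_projection[OF Y(1)] obtain m d where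
    fixed: "\<And>y. y \<in> Y \<Longrightarrow> (\<Sum>i<(m::nat). rank_one (d i) (d i) y) = y" and
    contr: "\<And>v. norm (\<Sum>i<m. rank_one (d i) (d i) v) \<le> norm v" by blast
  define P where "P = (\<lambda>v. \<Sum>i<m. rank_one (d i) (d i) v)"
  have linP: "bounded_linear P"
    unfolding P_def by (intro bounded_linear_sum bopD(1)[OF bop_rank_one])
  obtain S where S: "\<And>v w. cip J (S v) w = cip J v (a w)"
    using bop_adjoint[OF bop] by blast
  have "P (a v) = (\<Sum>i<m. rank_one (d i) (S (d i)) v)" for v
    unfolding P_def rank_one_def by (metis S cnj_cip)
  moreover have "norm (a v - P (a v)) \<le> e * norm v" for v
  proof (rule norm_le_of_unit_ball)
    show "linear (\<lambda>v. a v - P (a v))"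
      by (intro bounded_linear.linear bounded_linear_sub a.bounded_linear
          bounded_linear_compose[OF linP])
    fix v :: 'h assume "norm v \<le> 1"
    then obtain y where y: "y \<in> Y" "norm (a v - y) < e / 2" using Y(2) by blast
    have "P y = y" using fixed[OF y(1)] by (simp only: P_def)
    then have "a v - P (a v) = (a v - y) - P (a v - y)"
      by (simp add: linear_simps[OF linP])
    then have "norm (a v - P (a v)) \<le> norm (a v - y) + norm (P (a v - y))"
      by (metis norm_triangle_ineq4)
    also have "\<dots> \<le> norm (a v - y) + norm (a v - y)" using contr by (simp add: P_def)
    finally show "norm (a v - P (a v)) \<le> e" using y(2) by simp
  qed
  ultimately show ?thesis by (intro exI[of _ m] exI[of _ d] exI[of _ "\<lambda>i. S (d i)"]) simp
qed

section \<open>Complex spans of rank-one operators and their density\<close>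

definition csc_span :: "('h \<Rightarrow> 'h) set \<Rightarrow> ('h \<Rightarrow> 'h) set" where
  "csc_span A = {F. \<exists>(n::nat) c b. (\<forall>i<n. b i \<in> A) \<and> F = (\<lambda>v. \<Sum>i<n. csc J (c i) (b i v))}"

lemma csc_span_zero: "(\<lambda>v. 0) \<in> csc_span A"
  unfolding csc_span_def by (intro CollectI exI[of _ "0::nat"]) simp

lemma csc_span_add:
  assumes "F \<in> csc_span A" and "f \<in> A"
  shows "(\<lambda>v. F v + csc J z (f v)) \<in> csc_span A"
proof -
  obtain n c b where nb: "\<forall>i<(n::nat). b i \<in> A" "F = (\<lambda>v. \<Sum>i<n. csc J (c i) (b i v))"
    using assms(1) by (auto simp: csc_span_def)
  have "(\<Sum>i<n. csc J ((c(n := z)) i) ((b(n := f)) i v)) = F v" for v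
    unfolding nb(2) by (intro sum.cong) auto
  then have "(\<lambda>v. F v + csc J z (f v)) = (\<lambda>v. \<Sum>i<Suc n. csc J ((c(n := z)) i) ((b(n := f)) i v))"
    by simp
  moreover have "\<forall>i<Suc n. (b(n := f)) i \<in> A" using nb(1) assms(2) by (auto simp: less_Suc_eq)
  ultimately show ?thesis unfolding csc_span_def by blast
qed

text \<open>Polarization places a mixed operator in the span of the diagonal ones; its four vectors
  stay in \<open>D\<close> by the closure properties assumed.\<close>

lemma csc_span_add_rank_one:
  assumes F: "F \<in> csc_span ((\<lambda>x. rank_one x x) ` D)" and "x \<in> D" "y \<in> D"
    and "\<And>x y. x \<in> D \<Longrightarrow> y \<in> D \<Longrightarrow> x + y \<in> D"
    and "\<And>x y. x \<in> D \<Longrightarrow> y \<in> D \<Longrightarrow> x - y \<in> D"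
    and "\<And>x. x \<in> D \<Longrightarrow> J x \<in> D"
  shows "(\<lambda>v. F v + rank_one x y v) \<in> csc_span ((\<lambda>x. rank_one x x) ` D)"
proof -
  have "(\<lambda>v. F v + csc J (1/4) (rank_one (x + y) (x + y) v)
     + csc J (-1/4) (rank_one (x - y) (x - y) v)
     + csc J (\<i>/4) (rank_one (x + J y) (x + J y) v)
     + csc J (-\<i>/4) (rank_one (x - J y) (x - J y) v)) \<in> csc_span ((\<lambda>x. rank_one x x) ` D)"
    by (intro csc_span_add F imageI assms)
  then show ?thesis unfolding rank_one_polarization[of x y] by (simp only: add.assoc)
qed

lemma cpt_approx_by_span:
  assumes "cpt J a" and "e > 0" and dense: "closure D = UNIV"
    and add: "\<And>x y. x \<in> D \<Longrightarrow> y \<in> D \<Longrightarrow> x + y \<in> D"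
    and diff: "\<And>x y. x \<in> D \<Longrightarrow> y \<in> D \<Longrightarrow> x - y \<in> D"
    and J: "\<And>x. x \<in> D \<Longrightarrow> J x \<in> D"
  shows "\<exists>F \<in> csc_span ((\<lambda>x. rank_one x x) ` D). \<forall>v. norm (a v - F v) \<le> e * norm v"
proof -
  let ?S = "csc_span ((\<lambda>x. rank_one x x) ` D)"
  have near: "\<exists>x'\<in>D. norm (x - x') < d" if "d > 0" for x d
  proof -
    have "x \<in> closure D" using dense by simp
    then show ?thesis using that unfolding closure_approachable
      by (metis dist_norm norm_minus_commute)
  qed
  have approx: "\<exists>F\<in>?S. \<forall>v. norm ((\<Sum>i<m. rank_one (x i) (y i) v) - F v) \<le> e * norm v"
    if "e > 0" for e x y and m :: nat
    using that
  proof (induction m arbitrary: e)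
    case 0
    then show ?case by (intro bexI[OF _ csc_span_zero]) simp
  next
    case (Suc m)
    then obtain F where F: "F \<in> ?S"
      "\<And>v. norm ((\<Sum>i<m. rank_one (x i) (y i) v) - F v) \<le> (e / 2) * norm v"
      by (meson half_gt_zero)
    let ?x = "x m" and ?y = "y m"
    \<comment> \<open>The 1 keeps \<open>norm x'\<close> below \<open>norm ?x + 1\<close>; the other
      bound makes the two errors, from replacing \<open>?x\<close> and then \<open>?y\<close>, add
      up to at most \<open>e / 2\<close>.\<close>
    define d where "d = min 1 (e / 2 / (norm ?x + norm ?y + 1))"
    have pos: "norm ?x + norm ?y + 1 > 0" by (intro add_nonneg_pos) auto
    have d: "d > 0" "d \<le> 1" using Suc.prems pos by (auto simp: d_def)
    have "d \<le> e / 2 / (norm ?x + norm ?y + 1)" by (simp add: d_def)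
    then have de: "d * (norm ?x + norm ?y + 1) \<le> e / 2" using pos by (simp only: pos_le_divide_eq)
    obtain x' y' where xy: "x' \<in> D" "norm (?x - x') < d" "y' \<in> D" "norm (?y - y') < d"
      using near[OF d(1)] by meson
    have "norm x' \<le> norm ?x + norm (?x - x')" by (metis norm_minus_commute norm_triangle_sub)
    then have x': "norm x' \<le> norm ?x + 1" using xy(2) d(2) by linarith
    have step: "norm (rank_one ?x ?y v - rank_one x' y' v) \<le> (e / 2) * norm v" for v
    proof -
      have "rank_one ?x ?y v - rank_one x' y' v = rank_one (?x - x') ?y v + rank_one x' (?y - y') v"
        by (simp add: rank_one_def csc_diff_right cip_diff_right csc_diff_left)
      then have "norm (rank_one ?x ?y v - rank_one x' y' v)
          \<le> norm (rank_one (?x - x') ?y v) + norm (rank_one x' (?y - y') v)"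
        by (metis norm_triangle_ineq)
      also have "\<dots> \<le> norm (?x - x') * norm ?y * norm v + norm x' * norm (?y - y') * norm v"
        by (intro add_mono norm_rank_one_le)
      also have "\<dots> \<le> d * norm ?y * norm v + (norm ?x + 1) * d * norm v"
        using xy x' by (intro add_mono mult_mono mult_right_mono) auto
      also have "\<dots> = (d * (norm ?x + norm ?y + 1)) * norm v" by (simp add: algebra_simps)
      also have "\<dots> \<le> (e / 2) * norm v" by (rule mult_right_mono[OF de]) simp
      finally show ?thesis .
    qed
    have "norm ((\<Sum>i<Suc m. rank_one (x i) (y i) v) - (F v + rank_one x' y' v)) \<le> e * norm v" for v
    proof -
      have "norm ((\<Sum>i<Suc m. rank_one (x i) (y i) v) - (F v + rank_one x' y' v))
        \<le> norm ((\<Sum>i<m. rank_one (x i) (y i) v) - F v) + norm (rank_one ?x ?y v - rank_one x' y' v)"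
        using norm_triangle_ineq by (simp add: add_diff_add)
      also have "\<dots> \<le> (e / 2) * norm v + (e / 2) * norm v" by (intro add_mono F(2) step)
      finally show ?thesis by (simp add: algebra_simps)
    qed
    moreover have "(\<lambda>v. F v + rank_one x' y' v) \<in> ?S"
      by (intro csc_span_add_rank_one F xy add diff J)
    ultimately show ?case by (intro bexI) auto
  qed
  have "e / 2 > 0" using assms(2) by simp
  from cpt_finite_rank_approx[OF assms(1) this] obtain m x y where
    1: "\<And>v. norm (a v - (\<Sum>i<(m::nat). rank_one (x i) (y i) v)) \<le> (e / 2) * norm v" by blast
  from approx[OF \<open>e / 2 > 0\<close>, where m = m and x = x and y = y] obtain F where F: "F \<in> ?S" and
    2: "\<And>v. norm ((\<Sum>i<m. rank_one (x i) (y i) v) - F v) \<le> (e / 2) * norm v" by blast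
  have "norm (a v - F v) \<le> e * norm v" for v
  proof -
    have "norm (a v - F v) \<le> (e / 2) * norm v + (e / 2) * norm v"
      by (rule norm_diff_triangle_le[OF 1 2])
    then show ?thesis by (simp add: algebra_simps)
  qed
  with F show ?thesis by blast
qed

text \<open>On a norm-bounded set of self-adjoint operators, strong convergence implies strict convergence.
  For the products \<open>b \<circ> D\<close>, no compactness of the adjoint \<open>S\<close> of \<open>b\<close> is needed: with \<open>u = b (D v)\<close>,
  \<open>u \<bullet> u = u \<bullet> (u - C y) + C (v \<bullet> D (S y))\<close>, where \<open>y\<close> comes from a finite net of the image of the
  unit ball under \<open>b\<close>.\<close>

lemma strictly_small_of_small_on_finite:
  assumes "cpt J b" and "e > 0" and "C > 0"
  shows "\<exists>Y d. finite Y \<and> d > 0 \<and>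
    (\<forall>D. bounded_linear D \<and> (\<forall>v w. D v \<bullet> w = D w \<bullet> v) \<and> (\<forall>v. norm (D v) \<le> C * norm v) \<and>
       (\<forall>y\<in>Y. norm (D y) < d) \<longrightarrow> onorm (D \<circ> b) < e \<and> onorm (b \<circ> D) < e)"
proof -
  have bop: "bop J b" using assms(1) by (simp add: cpt_def)
  interpret b: bounded_linear b by (rule bopD(1)[OF bop])
  obtain \<beta> where \<beta>: "\<And>v. norm (b v) \<le> norm v * \<beta>" "\<beta> > 0"
    using b.pos_bounded by auto
  \<comment> \<open>In both minima the first entry serves \<open>D \<circ> b\<close>, with two
    errors of e/4. The second serves \<open>b \<circ> D\<close>, where the squared norm is split
    into two terms of at most e^2/8 each.\<close>
  define \<epsilon> where "\<epsilon> = min (e / (4 * C)) (e\<^sup>2 / (8 * \<beta> * C\<^sup>2))"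
  define d where "d = min (e / 4) (e\<^sup>2 / (8 * C))"
  have \<epsilon>: "\<epsilon> > 0" and d: "d > 0" using assms \<beta>(2) by (auto simp: \<epsilon>_def d_def)
  have "\<epsilon> \<le> e / (4 * C)" "\<epsilon> \<le> e\<^sup>2 / (8 * \<beta> * C\<^sup>2)" by (auto simp: \<epsilon>_def)
  then have \<epsilon>1: "C * \<epsilon> \<le> e / 4" and \<epsilon>2: "\<beta> * C\<^sup>2 * \<epsilon> \<le> e\<^sup>2 / 8"
    using assms(3) \<beta>(2) by (simp_all add: field_simps)
  have "d \<le> e / 4" "d \<le> e\<^sup>2 / (8 * C)" by (auto simp: d_def)
  then have d1: "d \<le> e / 4" and d2: "C * d \<le> e\<^sup>2 / 8"
    using assms(3) by (simp_all add: field_simps)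
  obtain Y where Y: "finite Y" "\<And>v. norm v \<le> 1 \<Longrightarrow> \<exists>y\<in>Y. norm (b v - y) < \<epsilon>"
    using cpt_finite_net[OF assms(1) \<epsilon>] by auto
  obtain S where S: "\<And>v w. S v \<bullet> w = v \<bullet> b w"
    using bop_adjoint[OF bop] by blast
  have small: "onorm (D \<circ> b) < e \<and> onorm (b \<circ> D) < e"
    if "bounded_linear D" and sym: "\<And>v w. D v \<bullet> w = D w \<bullet> v" and bound: "\<And>v. norm (D v) \<le> C * norm v"
      and small: "\<And>y. y \<in> Y \<union> S ` Y \<Longrightarrow> norm (D y) < d" for D
  proof
    interpret D: bounded_linear D by fact
    have 1: "norm (D (b v)) \<le> e / 2" if "norm v \<le> 1" for v
    proof -
      obtain y where y: "y \<in> Y" "norm (b v - y) < \<epsilon>" using Y(2)[OF \<open>norm v \<le> 1\<close>] by blast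
      have "norm (D (b v)) \<le> norm (D (b v - y)) + norm (D y)"
        using norm_triangle_ineq[of "D (b v - y)" "D y"] by (simp add: D.diff)
      also have "\<dots> \<le> C * norm (b v - y) + d"
        using bound[of "b v - y"] small[of y] y(1) by auto
      also have "\<dots> \<le> C * \<epsilon> + d" using y(2) assms(3) by simp
      finally show ?thesis using \<epsilon>1 d1 by simp
    qed
    have "linear (D \<circ> b)" by (intro linear_compose b.linear_axioms D.linear_axioms)
    then have "norm ((D \<circ> b) v) \<le> (e / 2) * norm v" for v
      by (rule norm_le_of_unit_ball) (simp only: o_apply 1)
    then have "onorm (D \<circ> b) \<le> e / 2" using assms(2) by (intro onorm_bound) auto
    then show "onorm (D \<circ> b) < e" using assms(2) by simp
    have 2: "norm (b (D v)) \<le> e / 2" if "norm v \<le> 1" for v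
    proof -
      define u where "u = b (D v)"
      have Dv: "norm (D v) \<le> C"
        by (rule order_trans[OF bound]) (use \<open>norm v \<le> 1\<close> assms(3) in simp)
      \<comment> \<open>The net covers only the image of the unit ball, so \<open>D v\<close> is
        scaled into that ball and the net point is scaled back by C.\<close>
      have "norm (D v /\<^sub>R C) \<le> 1" using Dv assms(3) by (simp add: field_simps)
      then obtain y where y: "y \<in> Y" "norm (b (D v /\<^sub>R C) - y) < \<epsilon>" using Y(2) by blast
      have "u - C *\<^sub>R y = C *\<^sub>R (b (D v /\<^sub>R C) - y)"
        using assms(3) by (simp add: u_def b.scaleR scaleR_diff_right)
      then have near: "norm (u - C *\<^sub>R y) \<le> C * \<epsilon>" using y(2) assms(3) by simp
      have nu: "norm u \<le> C * \<beta>"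
        unfolding u_def by (rule order_trans[OF \<beta>(1)]) (use Dv \<beta>(2) in simp)
      have "u \<bullet> y = v \<bullet> D (S y)"
        unfolding u_def by (metis S sym inner_commute)
      then have uu: "u \<bullet> u = u \<bullet> (u - C *\<^sub>R y) + C * (v \<bullet> D (S y))"
        by (simp add: inner_diff_right)
      have "u \<bullet> (u - C *\<^sub>R y) \<le> norm u * norm (u - C *\<^sub>R y)" by (rule norm_cauchy_schwarz)
      also have "\<dots> \<le> (C * \<beta>) * (C * \<epsilon>)"
        using nu near assms(3) \<beta>(2) by (intro mult_mono) auto
      also have "\<dots> \<le> e\<^sup>2 / 8" using \<epsilon>2 by (simp add: power2_eq_square mult_ac)
      finally have p: "u \<bullet> (u - C *\<^sub>R y) \<le> e\<^sup>2 / 8" .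
      have "v \<bullet> D (S y) \<le> norm v * norm (D (S y))" by (rule norm_cauchy_schwarz)
      also have "\<dots> \<le> 1 * d" using \<open>norm v \<le> 1\<close> small[of "S y"] y(1) d by (intro mult_mono) auto
      finally have "C * (v \<bullet> D (S y)) \<le> C * d" using assms(3) by simp
      with d2 uu p have "(norm u)\<^sup>2 \<le> e\<^sup>2 / 4" unfolding power2_norm_eq_inner by linarith
      then have "(norm u)\<^sup>2 \<le> (e / 2)\<^sup>2" by (simp add: power_divide)
      then show ?thesis unfolding u_def by (rule power2_le_imp_le) (use assms(2) in simp)
    qed
    have "linear (b \<circ> D)" by (intro linear_compose D.linear_axioms b.linear_axioms)
    then have "norm ((b \<circ> D) v) \<le> (e / 2) * norm v" for v
      by (rule norm_le_of_unit_ball) (simp only: o_apply 2)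
    then have "onorm (b \<circ> D) \<le> e / 2" using assms(2) by (intro onorm_bound) auto
    then show "onorm (b \<circ> D) < e" using assms(2) by simp
  qed
  show ?thesis
  proof (intro exI conjI allI impI)
    show "finite (Y \<union> S ` Y)" using Y(1) by simp
    fix D :: "'h \<Rightarrow> 'h"
    assume D: "bounded_linear D \<and> (\<forall>v w. D v \<bullet> w = D w \<bullet> v) \<and> (\<forall>v. norm (D v) \<le> C * norm v) \<and>
      (\<forall>y\<in>Y \<union> S ` Y. norm (D y) < d)"
    have "onorm (D \<circ> b) < e \<and> onorm (b \<circ> D) < e"
      using small[OF D[THEN conjunct1]] D by presburger
    then show "onorm (D \<circ> b) < e" and "onorm (b \<circ> D) < e" by simp_all
  qed (rule d)
qed

end

section \<open>Haar integrals of continuous functions\<close>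

lemma left_haar_space: "left_haar \<mu> \<Longrightarrow> space \<mu> = UNIV"
  using sets_eq_imp_space_eq[of \<mu> borel] by (simp add: left_haar_def)

lemma left_haar_measurable: "left_haar \<mu> \<Longrightarrow> borel_measurable \<mu> = borel_measurable borel"
  unfolding left_haar_def by (intro measurable_cong_sets) auto

lemma left_haar_nn_integral_le:
  fixes \<mu> :: "'g::{t2_space, group_add} measure" and f :: "'g \<Rightarrow> real" and M :: ennreal
  assumes haar: "left_haar \<mu>" and cont: "continuous_on UNIV f" and pos: "\<And>x. f x \<ge> 0"
    and le: "\<And>K. compact K \<Longrightarrow> (\<integral>\<^sup>+x. ennreal (f x) * indicator K x \<partial>\<mu>) \<le> M"
  shows "(\<integral>\<^sup>+x. ennreal (f x) \<partial>\<mu>) \<le> M"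
proof (cases "M = \<infinity>")
  case False
  have sets: "sets \<mu> = sets borel" using haar by (simp add: left_haar_def)
  have meas: "borel_measurable \<mu> = borel_measurable borel" by (rule left_haar_measurable[OF haar])
  have f_meas [measurable]: "f \<in> borel_measurable \<mu>"
    unfolding meas by (rule borel_measurable_continuous_onI[OF cont])
  have cpt_sets: "K \<in> sets \<mu>" if "compact K" for K
    unfolding sets using that by (intro borel_closed compact_imp_closed)
  define V where "V = (\<lambda>n::nat. {x. 1 / real (Suc n) < f x})"
  have openV: "open (V n)" for n
    unfolding V_def by (intro open_Collect_less cont continuous_on_const)
  have [measurable]: "V n \<in> sets \<mu>" for n unfolding sets by (intro borel_open openV)
  have inner: "emeasure \<mu> (V n) = (SUP K\<in>{K. compact K \<and> K \<subseteq> V n}. emeasure \<mu> K)" for n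
    using haar openV[of n] unfolding left_haar_def by (elim conjE) (drule spec, erule mp)
  \<comment> \<open>Markov's inequality on compact subsets; inner regularity then transfers the
    bound to \<open>V n\<close>.\<close>
  have "emeasure \<mu> K \<le> ennreal (real (Suc n)) * M" if K: "compact K" "K \<subseteq> V n" for K n
  proof -
    note [measurable] = cpt_sets[OF K(1)]
    have "emeasure \<mu> K = (\<integral>\<^sup>+x. indicator K x \<partial>\<mu>)" by simp
    also have "\<dots> \<le> (\<integral>\<^sup>+x. ennreal (real (Suc n)) * (ennreal (f x) * indicator K x) \<partial>\<mu>)"
    proof (intro nn_integral_mono)
      fix x
      show "indicator K x \<le> ennreal (real (Suc n)) * (ennreal (f x) * indicator K x)"
      proof (cases "x \<in> K")
        case True
        then have "1 / real (Suc n) < f x" using K(2) by (auto simp: V_def)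
        then have "1 \<le> real (Suc n) * f x" by (simp add: field_simps)
        then show ?thesis using True pos[of x] by (simp add: ennreal_mult[symmetric] del: of_nat_Suc)
      qed simp
    qed
    also have "\<dots> = ennreal (real (Suc n)) * (\<integral>\<^sup>+x. ennreal (f x) * indicator K x \<partial>\<mu>)"
      by (intro nn_integral_cmult) measurable
    also have "\<dots> \<le> ennreal (real (Suc n)) * M" by (intro mult_left_mono le K) simp
    finally show ?thesis .
  qed
  then have "emeasure \<mu> (V n) \<le> ennreal (real (Suc n)) * M" for n
    unfolding inner by (intro SUP_least) auto
  moreover have "ennreal (real (Suc n)) * M < \<infinity>" for n
    using False by (simp add: ennreal_mult_less_top less_top)
  ultimately have fin: "emeasure \<mu> (V n) < \<infinity>" for n by (rule le_less_trans)
  \<comment> \<open>The cap at height n makes the part of \<open>V n\<close> missed by a compact K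
    cost at most n times its measure; Fatou's lemma removes cap and cutoff at the end.\<close>
  define g where "g = (\<lambda>n x. ennreal (min (f x) (real n)) * indicator (V n) x)"
  have [measurable]: "g n \<in> borel_measurable \<mu>" for n unfolding g_def by measurable
  have g_le: "(\<integral>\<^sup>+x. g n x \<partial>\<mu>) \<le> M" for n
  proof (rule ennreal_le_epsilon)
    fix e :: real assume "e > 0"
    define d where "d = e / real (Suc n)"
    have d: "d > 0" using \<open>e > 0\<close> by (simp add: d_def)
    have "{K. compact K \<and> K \<subseteq> V n} \<noteq> {}" by (auto intro: exI[of _ "{}"])
    from SUP_approx_ennreal[OF d this inner] fin[of n]
    obtain K where K: "compact K" "K \<subseteq> V n" "emeasure \<mu> (V n) < emeasure \<mu> K + ennreal d"
      by (auto simp: less_top)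
    note [measurable] = cpt_sets[OF K(1)]
    have "emeasure \<mu> K \<le> emeasure \<mu> (V n)" by (intro emeasure_mono K) simp
    then have finK: "emeasure \<mu> K \<noteq> \<infinity>" using fin[of n] by (auto simp: top_unique)
    have "emeasure \<mu> (V n - K) = emeasure \<mu> (V n) - emeasure \<mu> K"
      by (intro emeasure_Diff) (use K finK in auto)
    also have "\<dots> \<le> ennreal d"
      using K(3) finK by (subst ennreal_minus_le_iff) (auto simp: add.commute)
    finally have diff: "emeasure \<mu> (V n - K) \<le> ennreal d" .
    have "(\<integral>\<^sup>+x. g n x \<partial>\<mu>) \<le>
        (\<integral>\<^sup>+x. ennreal (f x) * indicator K x + ennreal (real n) * indicator (V n - K) x \<partial>\<mu>)"
      using K(2) pos by (intro nn_integral_mono) (auto simp: g_def indicator_def intro!: ennreal_leI)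
    also have "\<dots> = (\<integral>\<^sup>+x. ennreal (f x) * indicator K x \<partial>\<mu>)
        + (\<integral>\<^sup>+x. ennreal (real n) * indicator (V n - K) x \<partial>\<mu>)"
      by (intro nn_integral_add) measurable
    also have "(\<integral>\<^sup>+x. ennreal (real n) * indicator (V n - K) x \<partial>\<mu>) = ennreal (real n) * emeasure \<mu> (V n - K)"
      by (intro nn_integral_cmult_indicator) measurable
    also have "(\<integral>\<^sup>+x. ennreal (f x) * indicator K x \<partial>\<mu>) + ennreal (real n) * emeasure \<mu> (V n - K)
        \<le> M + ennreal (real n) * ennreal d"
      by (intro add_mono le K mult_left_mono diff) simp
    also have "ennreal (real n) * ennreal d \<le> ennreal e"
      using \<open>e > 0\<close> d by (simp add: ennreal_mult[symmetric] d_def field_simps)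
    finally show "(\<integral>\<^sup>+x. g n x \<partial>\<mu>) \<le> M + ennreal e" by (simp add: add_left_mono)
  qed
  have "liminf (\<lambda>n. g n x) = ennreal (f x)" for x
  proof (rule lim_imp_Liminf)
    have "\<forall>\<^sub>F n in sequentially. g n x = ennreal (f x)"
    proof (cases "f x = 0")
      case True
      then show ?thesis by (simp add: g_def)
    next
      case False
      with pos[of x] have "f x > 0" by simp
      then have "1 / f x > 0" by simp
      obtain N1 :: nat where N1: "1 / f x < real N1" using reals_Archimedean2 by blast
      obtain N2 :: nat where N2: "f x < real N2" using reals_Archimedean2 by blast
      have "g n x = ennreal (f x)" if "n \<ge> max N1 N2" for n
      proof -
        have "1 / f x < real (Suc n)" using N1 that by simp
        then have "1 / real (Suc n) < f x" using \<open>f x > 0\<close> by (simp add: field_simps)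
        moreover have "f x \<le> real n" using N2 that by simp
        ultimately show ?thesis by (simp add: g_def V_def)
      qed
      then show ?thesis unfolding eventually_sequentially by blast
    qed
    then show "(\<lambda>n. g n x) \<longlonglongrightarrow> ennreal (f x)" by (rule tendsto_eventually)
  qed simp
  then have "(\<integral>\<^sup>+x. ennreal (f x) \<partial>\<mu>) = (\<integral>\<^sup>+x. liminf (\<lambda>n. g n x) \<partial>\<mu>)" by simp
  also have "\<dots> \<le> liminf (\<lambda>n. \<integral>\<^sup>+x. g n x \<partial>\<mu>)" by (intro nn_integral_liminf) simp
  also have "\<dots> \<le> limsup (\<lambda>n. \<integral>\<^sup>+x. g n x \<partial>\<mu>)" by (intro Liminf_le_Limsup) simp
  also have "\<dots> \<le> M" by (intro Limsup_bounded always_eventually allI g_le)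
  finally show ?thesis .
qed simp

text \<open>If every tail were at least \<open>e\<close>, every integral over a compact set would be
  at most the total minus \<open>e\<close>, and by the previous lemma so would the total
  itself.\<close>

lemma left_haar_compact_tail:
  fixes \<mu> :: "'g::{t2_space, group_add} measure" and f :: "'g \<Rightarrow> real"
  assumes haar: "left_haar \<mu>" and cont: "continuous_on UNIV f" and pos: "\<And>x. f x \<ge> 0"
    and fin: "integrable \<mu> f" and "e > 0"
  shows "\<exists>K. compact K \<and> (\<integral>x. indicator (- K) x * f x \<partial>\<mu>) < e"
proof (rule ccontr)
  assume "\<nexists>K. compact K \<and> (\<integral>x. indicator (- K) x * f x \<partial>\<mu>) < e"
  then have tail: "e \<le> (\<integral>x. indicator (- K) x * f x \<partial>\<mu>)" if "compact K" for K
    using that by force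
  have sets: "sets \<mu> = sets borel" using haar by (simp add: left_haar_def)
  let ?I = "\<integral>x. f x \<partial>\<mu>"
  have int: "integrable \<mu> (\<lambda>x. indicator A x * f x)" if "A \<in> sets \<mu>" for A
    using integrable_mult_indicator[OF that fin] by simp
  have K_sets: "K \<in> sets \<mu>" "- K \<in> sets \<mu>" if "compact K" for K
    unfolding sets using borel_closed[OF compact_imp_closed[OF that]] by auto
  have "(\<integral>\<^sup>+x. ennreal (f x) * indicator K x \<partial>\<mu>) \<le> ennreal (?I - e)" if K: "compact K" for K
  proof -
    have "?I = (\<integral>x. indicator K x * f x + indicator (- K) x * f x \<partial>\<mu>)"
      by (intro Bochner_Integration.integral_cong) (auto simp: indicator_def)
    also have "\<dots> = (\<integral>x. indicator K x * f x \<partial>\<mu>) + (\<integral>x. indicator (- K) x * f x \<partial>\<mu>)"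
      by (intro Bochner_Integration.integral_add int K_sets K)
    finally have le: "(\<integral>x. indicator K x * f x \<partial>\<mu>) \<le> ?I - e" using tail[OF K] by simp
    have "(\<integral>\<^sup>+x. ennreal (f x) * indicator K x \<partial>\<mu>) = (\<integral>\<^sup>+x. ennreal (indicator K x * f x) \<partial>\<mu>)"
      by (intro nn_integral_cong) (auto simp: indicator_def)
    also have "\<dots> = ennreal (\<integral>x. indicator K x * f x \<partial>\<mu>)"
      by (intro nn_integral_eq_integral int K_sets K) (auto simp: pos)
    finally show ?thesis using le by (simp add: ennreal_leI)
  qed
  then have "(\<integral>\<^sup>+x. ennreal (f x) \<partial>\<mu>) \<le> ennreal (?I - e)"
    by (rule left_haar_nn_integral_le[OF haar cont pos])
  then have "ennreal ?I \<le> ennreal (?I - e)"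
    by (subst (asm) nn_integral_eq_integral[OF fin]) (auto simp: pos)
  \<comment> \<open>\<open>ennreal\<close> sends negative reals to 0, so the contradiction needs
    \<open>?I - e\<close> to be nonnegative; the tail of the empty set provides this.\<close>
  moreover have "?I \<ge> e"
    using tail[of "{}"] by simp
  ultimately show False using assms(5) by (simp add: ennreal_le_iff)
qed

section \<open>Square-integrable representations\<close>

locale haar_rep = complex_hilbert J
  for J :: "'h::{real_inner, complete_space} \<Rightarrow> 'h" +
  fixes \<mu> :: "'g::{t2_space, group_add} measure"
    and U :: "'g \<Rightarrow> 'h \<Rightarrow> 'h"
  assumes lc: "lc_group TYPE('g)"
    and haar: "left_haar \<mu>"
    and rep: "sc_unitary_rep J U"
begin

section \<open>The representation and the induced action\<close>

lemma bop_U: "bop J (U x)" and norm_U [simp]: "norm (U x v) = norm v"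
  and U_add: "U (x + y) v = U x (U y v)" and U_zero: "U 0 v = v"
  using rep by (auto simp: sc_unitary_rep_def unitary_op_def)

lemma U_U_minus [simp]: "U x (U (- x) v) = v" "U (- x) (U x v) = v"
  by (simp_all add: U_add[symmetric] U_zero)

lemma inner_U_U: "U x v \<bullet> U x w = v \<bullet> w"
proof -
  interpret bounded_linear "U x" by (rule bopD(1)[OF bop_U])
  have "(norm (U x (v + w)))\<^sup>2 = (norm (v + w))\<^sup>2" by simp
  then show ?thesis
    unfolding add dot_norm by simp
qed

lemma inner_U: "U x v \<bullet> w = v \<bullet> U (- x) w"
  using inner_U_U[of x v "U (- x) w"] by simp

lemma cip_U: "cip J (U x v) w = cip J v (U (- x) w)"
  by (simp add: cip_def inner_U bopD(2)[OF bop_U])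

lemma hadj_U: "hadj (U x) = U (- x)"
  unfolding hadj_def
proof (rule the_equality)
  show "\<forall>v w. U x v \<bullet> w = v \<bullet> U (- x) w" by (simp add: inner_U)
  fix S assume S: "\<forall>v w. U x v \<bullet> w = v \<bullet> S w"
  show "S = U (- x)"
  proof
    fix w
    have "v \<bullet> S w = v \<bullet> U (- x) w" for v using S by (simp add: inner_U)
    then show "S w = U (- x) w" using vector_eq_ldot by blast
  qed
qed

lemma act_apply: "act U x a v = U x (a (U (- x) v))"
  by (simp add: act_def hadj_U)

lemma inner_act: "act U x a v \<bullet> w = a (U (- x) v) \<bullet> U (- x) w"
  by (simp add: act_apply inner_U)

lemma bop_act:
  assumes "bop J a"
  shows "bop J (act U x a)"
  unfolding act_def hadj_U by (intro bop_compose bop_U assms)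

lemma continuous_U: "continuous_on UNIV (\<lambda>x. U x v)"
  using rep by (simp add: sc_unitary_rep_def)

lemma continuous_U_minus: "continuous_on UNIV (\<lambda>x. U (- x) v)"
proof -
  have "continuous_on UNIV (uminus :: 'g \<Rightarrow> 'g)" using lc by (simp add: lc_group_def)
  from continuous_on_compose[OF this, of "\<lambda>x. U x v"] show ?thesis
    using continuous_on_subset[OF continuous_U] by (auto simp: o_def)
qed

lemma continuous_inner_act:
  assumes "bop J a"
  shows "continuous_on UNIV (\<lambda>x. act U x a v \<bullet> w)"
  unfolding inner_act
  by (intro continuous_on_inner bounded_linear.continuous_on[OF bopD(1)[OF assms]] continuous_U_minus)

lemma measurable_mu: "borel_measurable \<mu> = borel_measurable borel"
  by (rule left_haar_measurable[OF haar])

lemma measurable_inner_act: "bop J a \<Longrightarrow> (\<lambda>x. act U x a v \<bullet> w) \<in> borel_measurable \<mu>"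
  unfolding measurable_mu by (intro borel_measurable_continuous_onI continuous_inner_act)

lemma compact_sets: "compact K \<Longrightarrow> K \<in> sets \<mu>"
  using haar by (auto simp: left_haar_def intro: borel_closed compact_imp_closed)

lemma emeasure_compact: "compact K \<Longrightarrow> emeasure \<mu> K < \<infinity>"
  using haar by (simp add: left_haar_def)

section \<open>Matrix coefficients and the linear space of U-bounded vectors\<close>

definition coef :: "'h \<Rightarrow> 'h \<Rightarrow> 'g \<Rightarrow> real" where
  "coef \<xi> v x = cmod (cip J (U x \<xi>) v)"

lemma coef_nonneg [simp]: "coef \<xi> v x \<ge> 0"
  by (simp add: coef_def)

lemma continuous_coef: "continuous_on UNIV (coef \<xi> v)"
  unfolding coef_def cip_def Complex_eq
  by (intro continuous_intros continuous_U)

lemma measurable_coef: "coef \<xi> v \<in> borel_measurable \<mu>"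
  unfolding measurable_mu by (intro borel_measurable_continuous_onI continuous_coef)

lemma U_bounded_iff:
  "U_bounded \<mu> J U \<xi> \<longleftrightarrow>
    (\<exists>C. 0 \<le> C \<and> (\<forall>v. (\<integral>\<^sup>+x. ennreal ((coef \<xi> v x)\<^sup>2) \<partial>\<mu>) \<le> ennreal (C * (norm v)\<^sup>2)))"
  (is "_ \<longleftrightarrow> ?R")
proof
  assume "U_bounded \<mu> J U \<xi>"
  then obtain k where
    "\<And>v. (\<integral>\<^sup>+x. ennreal ((coef \<xi> v x)\<^sup>2) \<partial>\<mu>) \<le> ennreal ((k * norm v)\<^sup>2)"
    by (auto simp: U_bounded_def coef_def)
  then show ?R by (intro exI[of _ "k\<^sup>2"]) (simp add: power_mult_distrib)
next
  assume ?R
  then obtain C where "0 \<le> C"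
    "\<And>v. (\<integral>\<^sup>+x. ennreal ((coef \<xi> v x)\<^sup>2) \<partial>\<mu>) \<le> ennreal (C * (norm v)\<^sup>2)" by blast
  then show "U_bounded \<mu> J U \<xi>"
    unfolding U_bounded_def coef_def by (intro exI[of _ "sqrt C"]) (simp add: power_mult_distrib)
qed

lemma U_bounded_add:
  assumes "U_bounded \<mu> J U \<xi>" and "U_bounded \<mu> J U \<zeta>"
  shows "U_bounded \<mu> J U (\<xi> + \<zeta>)"
proof -
  obtain C where C: "0 \<le> C"
    "\<And>v. (\<integral>\<^sup>+x. ennreal ((coef \<xi> v x)\<^sup>2) \<partial>\<mu>) \<le> ennreal (C * (norm v)\<^sup>2)"
    using assms(1) by (auto simp: U_bounded_iff)
  obtain D where D: "0 \<le> D"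
    "\<And>v. (\<integral>\<^sup>+x. ennreal ((coef \<zeta> v x)\<^sup>2) \<partial>\<mu>) \<le> ennreal (D * (norm v)\<^sup>2)"
    using assms(2) by (auto simp: U_bounded_iff)
  note [measurable] = measurable_coef
  have "(\<integral>\<^sup>+x. ennreal ((coef (\<xi> + \<zeta>) v x)\<^sup>2) \<partial>\<mu>) \<le> ennreal ((2 * C + 2 * D) * (norm v)\<^sup>2)" for v
  proof -
    have sq: "(coef (\<xi> + \<zeta>) v x)\<^sup>2 \<le> 2 * (coef \<xi> v x)\<^sup>2 + 2 * (coef \<zeta> v x)\<^sup>2" for x
    proof -
      have "coef (\<xi> + \<zeta>) v x \<le> coef \<xi> v x + coef \<zeta> v x"
        unfolding coef_def by (simp add: linear_simps[OF bopD(1)[OF bop_U]] cip_add_left norm_triangle_ineq)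
      then have "(coef (\<xi> + \<zeta>) v x)\<^sup>2 \<le> (coef \<xi> v x + coef \<zeta> v x)\<^sup>2" by (intro power_mono) auto
      also have "\<dots> \<le> 2 * (coef \<xi> v x)\<^sup>2 + 2 * (coef \<zeta> v x)\<^sup>2"
        using zero_le_power2[of "coef \<xi> v x - coef \<zeta> v x"] by (simp add: power2_eq_square algebra_simps)
      finally show ?thesis .
    qed
    have "(\<integral>\<^sup>+x. ennreal ((coef (\<xi> + \<zeta>) v x)\<^sup>2) \<partial>\<mu>)
        \<le> (\<integral>\<^sup>+x. 2 * ennreal ((coef \<xi> v x)\<^sup>2) + 2 * ennreal ((coef \<zeta> v x)\<^sup>2) \<partial>\<mu>)"
      using ennreal_leI[OF sq] by (intro nn_integral_mono) (simp add: ennreal_plus ennreal_mult)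
    also have "\<dots> = 2 * (\<integral>\<^sup>+x. ennreal ((coef \<xi> v x)\<^sup>2) \<partial>\<mu>) + 2 * (\<integral>\<^sup>+x. ennreal ((coef \<zeta> v x)\<^sup>2) \<partial>\<mu>)"
      by (simp add: nn_integral_add nn_integral_cmult)
    also have "\<dots> \<le> 2 * ennreal (C * (norm v)\<^sup>2) + 2 * ennreal (D * (norm v)\<^sup>2)"
      by (intro add_mono mult_left_mono C D) auto
    also have "\<dots> = ennreal (2 * (C * (norm v)\<^sup>2) + 2 * (D * (norm v)\<^sup>2))"
      using C(1) D(1) by (simp add: ennreal_plus ennreal_mult)
    finally show ?thesis by (simp add: algebra_simps)
  qed
  moreover have "0 \<le> 2 * C + 2 * D" using C(1) D(1) by simp
  ultimately show ?thesis unfolding U_bounded_iff by blast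
qed

lemma U_bounded_csc:
  assumes "U_bounded \<mu> J U \<xi>"
  shows "U_bounded \<mu> J U (csc J c \<xi>)"
proof -
  obtain C where C: "0 \<le> C"
    "\<And>v. (\<integral>\<^sup>+x. ennreal ((coef \<xi> v x)\<^sup>2) \<partial>\<mu>) \<le> ennreal (C * (norm v)\<^sup>2)"
    using assms by (auto simp: U_bounded_iff)
  note [measurable] = measurable_coef
  have "(\<integral>\<^sup>+x. ennreal ((coef (csc J c \<xi>) v x)\<^sup>2) \<partial>\<mu>) \<le> ennreal (((cmod c)\<^sup>2 * C) * (norm v)\<^sup>2)" for v
  proof -
    have "(\<integral>\<^sup>+x. ennreal ((coef (csc J c \<xi>) v x)\<^sup>2) \<partial>\<mu>)
      = (\<integral>\<^sup>+x. ennreal ((cmod c)\<^sup>2) * ennreal ((coef \<xi> v x)\<^sup>2) \<partial>\<mu>)"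
      by (simp add: coef_def bop_csc[OF bop_U] cip_csc_left norm_mult power_mult_distrib ennreal_mult)
    also have "\<dots> = ennreal ((cmod c)\<^sup>2) * (\<integral>\<^sup>+x. ennreal ((coef \<xi> v x)\<^sup>2) \<partial>\<mu>)"
      by (intro nn_integral_cmult) measurable
    also have "\<dots> \<le> ennreal ((cmod c)\<^sup>2) * ennreal (C * (norm v)\<^sup>2)"
      by (intro mult_left_mono C) simp
    also have "\<dots> = ennreal (((cmod c)\<^sup>2 * C) * (norm v)\<^sup>2)"
      using C(1) by (simp add: ennreal_mult[symmetric] mult.assoc)
    finally show ?thesis .
  qed
  moreover have "0 \<le> (cmod c)\<^sup>2 * C" using C(1) by simp
  ultimately show ?thesis unfolding U_bounded_iff by blast
qed

lemma U_bounded_zero: "U_bounded \<mu> J U 0"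
  unfolding U_bounded_def by (simp add: linear_simps[OF bopD(1)[OF bop_U]] cip_def Complex_eq)

lemma U_bounded_J: "U_bounded \<mu> J U \<xi> \<Longrightarrow> U_bounded \<mu> J U (J \<xi>)"
  using U_bounded_csc[of \<xi> \<i>] by (simp add: csc_def)

lemma U_bounded_diff:
  assumes "U_bounded \<mu> J U \<xi>" and "U_bounded \<mu> J U \<zeta>"
  shows "U_bounded \<mu> J U (\<xi> - \<zeta>)"
  using U_bounded_add[OF assms(1) U_bounded_csc[OF assms(2), of "-1"]] by (simp add: csc_def)

lemma U_bounded_sum:
  "(\<And>i. i < (n::nat) \<Longrightarrow> U_bounded \<mu> J U (f i)) \<Longrightarrow> U_bounded \<mu> J U (\<Sum>i<n. f i)"
  by (induction n) (auto simp: U_bounded_zero intro: U_bounded_add)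

subsection \<open>Weak operator integrals\<close>

text \<open>By Riesz the integrated bilinear form is an operator, and it is complex linear because
  every translate of \<open>a\<close> commutes with \<open>J\<close>. The weight is left general so
  that the same construction yields both the operators p_l and their limit.\<close>

lemma weak_integral_operator:
  assumes bop: "bop J a"
    and int: "\<And>v w. integrable \<mu> (\<lambda>x. g x * (act U x a v \<bullet> w))"
    and bound: "\<And>v w. norm v \<le> 1 \<Longrightarrow> norm w \<le> 1 \<Longrightarrow> \<bar>\<integral>x. g x * (act U x a v \<bullet> w) \<partial>\<mu>\<bar> \<le> C"
  shows "\<exists>T. bop J T \<and> (\<forall>v w. T v \<bullet> w = (\<integral>x. g x * (act U x a v \<bullet> w) \<partial>\<mu>)) \<and>
    (\<forall>v. norm (T v) \<le> C * norm v)"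
proof -
  note act_lin = linear_simps[OF bopD(1)[OF bop_act[OF bop]]]
  define B where "B = (\<lambda>v w. \<integral>x. g x * (act U x a v \<bullet> w) \<partial>\<mu>)"
  have add: "B (v + v') w = B v w + B v' w" "B v (w + w') = B v w + B v w'" for v v' w w'
    unfolding B_def act_lin inner_add distrib_left
    by (intro Bochner_Integration.integral_add int)+
  have scale: "B (r *\<^sub>R v) w = r * B v w" "B v (r *\<^sub>R w) = r * B v w" for r v w
    unfolding B_def act_lin by (simp_all add: mult.left_commute)
  have Bb: "\<bar>B v w\<bar> \<le> norm v * norm w * C" for v w
  proof (cases "v = 0 \<or> w = 0")
    case True
    then show ?thesis using scale(1)[of 0 v w] scale(2)[of v 0 w] by auto
  next
    case False
    have "\<bar>B (v /\<^sub>R norm v) (w /\<^sub>R norm w)\<bar> \<le> C"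
      unfolding B_def using False by (intro bound) auto
    then show ?thesis using False by (simp add: scale abs_mult field_simps)
  qed
  have "bounded_bilinear B"
    by unfold_locales (use add scale Bb in auto)
  then obtain T where T: "bounded_linear T" "\<And>v w. T v \<bullet> w = B v w"
    using bounded_form_operator by blast
  have "T (J v) = J (T v)" for v
  proof (rule vector_eq_rdot[THEN iffD1], rule allI)
    fix w
    have "B (J v) w = - B v (J w)"
      unfolding B_def by (simp add: bopD(2)[OF bop_act[OF bop]] inner_J_left)
    then show "T (J v) \<bullet> w = J (T v) \<bullet> w" by (simp add: T(2) inner_J_left)
  qed
  moreover have "norm (T v) \<le> C * norm v" for v
  proof (cases "T v = 0")
    case True
    have "\<bar>\<integral>x. g x * (act U x a 0 \<bullet> 0) \<partial>\<mu>\<bar> \<le> C" by (intro bound) auto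
    then have "0 \<le> C" by simp
    with True show ?thesis by simp
  next
    case False
    have "norm (T v) * norm (T v) = B v (T v)"
      by (simp add: T(2)[symmetric] dot_square_norm power2_eq_square)
    also have "\<dots> \<le> (C * norm v) * norm (T v)" using Bb[of v "T v"] by (simp add: mult_ac)
    finally show ?thesis using False by simp
  qed
  ultimately show ?thesis using T by (intro exI[of _ T]) (auto simp: bop_def B_def)
qed

section \<open>Cut-off functions and the operators p_l\<close>

lemma BsetD:
  assumes "l \<in> Bset \<mu>"
  shows "l \<in> borel_measurable \<mu>" and "0 \<le> l x" and "l x \<le> 1"
    and "\<exists>K. compact K \<and> (\<forall>x. \<bar>l x\<bar> \<le> indicator K x)"
proof -
  show "l \<in> borel_measurable \<mu>" "0 \<le> l x" "l x \<le> 1" using assms by (auto simp: Bset_def)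
  obtain K where K: "compact K" "\<And>x. x \<notin> K \<Longrightarrow> l x = 0" using assms by (auto simp: Bset_def)
  have "\<bar>l x\<bar> \<le> indicator K x" for x
    using K(2)[of x] assms by (cases "x \<in> K") (auto simp: Bset_def)
  with K(1) show "\<exists>K. compact K \<and> (\<forall>x. \<bar>l x\<bar> \<le> indicator K x)" by blast
qed

lemma indicator_in_Bset: "compact K \<Longrightarrow> indicator K \<in> Bset \<mu>"
  unfolding Bset_def using compact_sets[of K] by (auto simp: indicator_def intro: exI[of _ K])

lemma max_in_Bset:
  assumes "l \<in> Bset \<mu>" and "l' \<in> Bset \<mu>"
  shows "(\<lambda>x. max (l x) (l' x)) \<in> Bset \<mu>"
proof -
  obtain K K' where "compact K" "\<And>x. x \<notin> K \<Longrightarrow> l x = 0" "compact K'" "\<And>x. x \<notin> K' \<Longrightarrow> l' x = 0"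
    using assms by (auto simp: Bset_def)
  then have "compact (K \<union> K')" "\<forall>x. x \<notin> K \<union> K' \<longrightarrow> max (l x) (l' x) = 0"
    by (auto intro: compact_Un)
  then have "\<exists>L. compact L \<and> (\<forall>x. x \<notin> L \<longrightarrow> max (l x) (l' x) = 0)" by blast
  then show ?thesis using assms unfolding Bset_def by (auto simp: le_max_iff_disj)
qed

text \<open>The integrand is dominated by a constant times the indicator of a compact set, which has
  finite Haar measure. The resulting bound depends on that set, so it gives existence of p_l but no
  control uniform in l.\<close>

lemma Bset_act_bound:
  assumes "bop J a" and "l \<in> Bset \<mu>"
  shows "integrable \<mu> (\<lambda>x. l x * (act U x a v \<bullet> w))"
    and "\<exists>C. \<forall>v w. norm v \<le> 1 \<longrightarrow> norm w \<le> 1 \<longrightarrow> \<bar>\<integral>x. l x * (act U x a v \<bullet> w) \<partial>\<mu>\<bar> \<le> C"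
proof -
  obtain K where K: "compact K" "\<And>x. \<bar>l x\<bar> \<le> indicator K x" using BsetD(4)[OF assms(2)] by blast
  obtain c where c: "\<And>v. norm (a v) \<le> norm v * c" "c > 0"
    using bounded_linear.pos_bounded[OF bopD(1)[OF assms(1)]] by auto
  have int_K: "integrable \<mu> (indicator K :: 'g \<Rightarrow> real)"
    using compact_sets[OF K(1)] emeasure_compact[OF K(1)] by (simp add: integrable_indicator_iff)
  note [measurable] = BsetD(1)[OF assms(2)] measurable_inner_act[OF assms(1)]
  have pt: "\<bar>l x * (act U x a v \<bullet> w)\<bar> \<le> (norm v * c * norm w) * indicator K x" for x v w
  proof -
    have "\<bar>act U x a v \<bullet> w\<bar> \<le> norm (act U x a v) * norm w" by (rule Cauchy_Schwarz_ineq2)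
    also have "\<dots> \<le> norm v * c * norm w"
      using c(1)[of "U (- x) v"] by (intro mult_right_mono) (auto simp: act_apply)
    finally have "\<bar>l x\<bar> * \<bar>act U x a v \<bullet> w\<bar> \<le> indicator K x * (norm v * c * norm w)"
      by (intro mult_mono K) auto
    then show ?thesis by (simp add: abs_mult mult_ac)
  qed
  show int: "integrable \<mu> (\<lambda>x. l x * (act U x a v \<bullet> w))" for v w
    by (rule Bochner_Integration.integrable_bound[OF integrable_mult_right[OF int_K, of "norm v * c * norm w"]])
       (use pt in \<open>auto simp: c(2) less_imp_le abs_mult\<close>)
  have "\<bar>\<integral>x. l x * (act U x a v \<bullet> w) \<partial>\<mu>\<bar> \<le> c * measure \<mu> K" if "norm v \<le> 1" "norm w \<le> 1" for v w
  proof -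
    have "\<bar>\<integral>x. l x * (act U x a v \<bullet> w) \<partial>\<mu>\<bar> \<le> (\<integral>x. \<bar>l x * (act U x a v \<bullet> w)\<bar> \<partial>\<mu>)"
      by (rule integral_abs_bound)
    also have "\<dots> \<le> (\<integral>x. (norm v * c * norm w) * indicator K x \<partial>\<mu>)"
      by (intro integral_mono integrable_abs int integrable_mult_right int_K pt)
    also have "\<dots> = (norm v * norm w) * (c * measure \<mu> K)"
      using compact_sets[OF K(1)] by simp
    also have "\<dots> \<le> 1 * (c * measure \<mu> K)"
      using that c(2) by (intro mult_right_mono mult_le_one) auto
    finally show ?thesis by simp
  qed
  then show "\<exists>C. \<forall>v w. norm v \<le> 1 \<longrightarrow> norm w \<le> 1 \<longrightarrow> \<bar>\<integral>x. l x * (act U x a v \<bullet> w) \<partial>\<mu>\<bar> \<le> C" by blast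
qed

text \<open>The definite description denotes: \<open>weak_integral_operator\<close> gives existence,
  and an operator is determined by its inner products.\<close>

lemma p_op:
  assumes "bop J a" and "l \<in> Bset \<mu>"
  shows "bop J (p_op \<mu> J U l a)"
    and "p_op \<mu> J U l a v \<bullet> w = (\<integral>x. l x * (act U x a v \<bullet> w) \<partial>\<mu>)"
proof -
  obtain C where "\<And>v w. norm v \<le> 1 \<Longrightarrow> norm w \<le> 1 \<Longrightarrow> \<bar>\<integral>x. l x * (act U x a v \<bullet> w) \<partial>\<mu>\<bar> \<le> C"
    using Bset_act_bound(2)[OF assms] by blast
  from weak_integral_operator[OF assms(1) Bset_act_bound(1)[OF assms] this]
  obtain T where T: "bop J T" "\<And>v w. T v \<bullet> w = (\<integral>x. l x * (act U x a v \<bullet> w) \<partial>\<mu>)" by blast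
  have "p_op \<mu> J U l a = T"
    unfolding p_op_def
  proof (rule the_equality)
    show "bop J T \<and> (\<forall>v w. T v \<bullet> w = (\<integral>x. l x * (act U x a v \<bullet> w) \<partial>\<mu>))" using T by blast
    fix S assume S: "bop J S \<and> (\<forall>v w. S v \<bullet> w = (\<integral>x. l x * (act U x a v \<bullet> w) \<partial>\<mu>))"
    show "S = T"
    proof
      fix v
      have "S v \<bullet> w = T v \<bullet> w" for w using S by (simp add: T(2))
      then show "S v = T v" using vector_eq_rdot by blast
    qed
  qed
  with T show "bop J (p_op \<mu> J U l a)" and "p_op \<mu> J U l a v \<bullet> w = (\<integral>x. l x * (act U x a v \<bullet> w) \<partial>\<mu>)"
    by simp_all
qed

subsection \<open>Properness implies square-integrability\<close>

text \<open>The integrand is nonnegative, so enlarging the cut-off only increases the integral; any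
  \<open>l\<close> may be replaced by its maximum with the threshold \<open>l0\<close> of the net,
  where p_l is already close to \<open>T\<close>.\<close>

lemma proper_elem_integral_le:
  assumes a: "cpt_pos J a" and T: "bop J T"
    and lim: "\<And>b e. cpt J b \<Longrightarrow> e > 0 \<Longrightarrow> \<exists>l0\<in>Bset \<mu>. \<forall>l\<in>Bset \<mu>. l0 \<le> l \<longrightarrow>
      onorm ((\<lambda>v. p_op \<mu> J U l a v - T v) \<circ> b) < e"
    and l: "l \<in> Bset \<mu>"
  shows "(\<integral>x. l x * (act U x a v \<bullet> v) \<partial>\<mu>) \<le> T v \<bullet> v"
proof (cases "v = 0")
  case True
  then show ?thesis by simp
next
  case False
  note bop = cpt_posD(2)[OF a]
  show ?thesis
  proof (rule field_le_epsilon)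
    fix e :: real assume "e > 0"
    \<comment> \<open>\<open>?b\<close> multiplies \<open>v\<close> by its squared norm, so the norm
      of \<open>D \<circ> ?b\<close> controls \<open>D v\<close>.\<close>
    let ?b = "rank_one v v"
    from lim[OF cpt_rank_one \<open>e > 0\<close>] obtain l0 where l0: "l0 \<in> Bset \<mu>"
      "\<And>l. l \<in> Bset \<mu> \<Longrightarrow> l0 \<le> l \<Longrightarrow> onorm ((\<lambda>v. p_op \<mu> J U l a v - T v) \<circ> ?b) < e"
      by blast
    define l1 where "l1 = (\<lambda>x. max (l x) (l0 x))"
    have l1: "l1 \<in> Bset \<mu>" unfolding l1_def by (rule max_in_Bset[OF l l0(1)])
    define D where "D = (\<lambda>v. p_op \<mu> J U l1 a v - T v)"
    have bop_D: "bop J D" unfolding D_def by (intro bop_diff p_op(1) bop l1 T)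
    have bl: "bounded_linear (D \<circ> ?b)" by (intro bopD(1) bop_compose bop_D bop_rank_one)
    have small: "onorm (D \<circ> ?b) < e"
      unfolding D_def by (rule l0(2)[OF l1]) (simp add: l1_def le_fun_def)
    have "?b v = (norm v)\<^sup>2 *\<^sub>R v" by (rule rank_one_self)
    then have "D (?b v) = (norm v)\<^sup>2 *\<^sub>R D v"
      by (simp add: linear_simps[OF bopD(1)[OF bop_D]])
    then have "(norm v)\<^sup>2 * norm (D v) \<le> onorm (D \<circ> ?b) * norm v"
      using onorm[OF bl, of v] by simp
    also have "\<dots> \<le> e * norm v" using small by (intro mult_right_mono) auto
    finally have "norm v * (norm v * norm (D v)) \<le> norm v * e"
      by (simp add: power2_eq_square mult_ac)
    then have "norm (D v) * norm v \<le> e" using False by (simp add: mult.commute)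
    then have "D v \<bullet> v \<le> e" using norm_cauchy_schwarz[of "D v" v] by simp
    then have "p_op \<mu> J U l1 a v \<bullet> v \<le> T v \<bullet> v + e" by (simp add: D_def inner_diff_left)
    moreover have "(\<integral>x. l x * (act U x a v \<bullet> v) \<partial>\<mu>) \<le> p_op \<mu> J U l1 a v \<bullet> v"
      unfolding p_op(2)[OF bop l1]
      by (intro integral_mono Bset_act_bound(1) bop l l1 mult_right_mono)
         (auto simp: l1_def inner_act intro: cpt_posD(3)[OF a])
    ultimately show "(\<integral>x. l x * (act U x a v \<bullet> v) \<partial>\<mu>) \<le> T v \<bullet> v + e" by simp
  qed
qed

lemma proper_elem_range_U_bounded:
  assumes "alpha_proper_elem \<mu> J U a"
  shows "U_bounded \<mu> J U (a \<zeta>)"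
proof -
  have a: "cpt_pos J a" using assms by (simp add: alpha_proper_elem_def)
  note bop = cpt_posD(2)[OF a]
  obtain T where T: "bop J T" and
    lim: "\<And>b e. cpt J b \<Longrightarrow> e > 0 \<Longrightarrow> \<exists>l0\<in>Bset \<mu>. \<forall>l\<in>Bset \<mu>. l0 \<le> l \<longrightarrow>
      onorm ((\<lambda>v. p_op \<mu> J U l a v - T v) \<circ> b) < e"
    using assms unfolding alpha_proper_elem_def by meson
  obtain t where t: "\<And>v. norm (T v) \<le> norm v * t" "t > 0"
    using bounded_linear.pos_bounded[OF bopD(1)[OF T]] by auto
  \<comment> \<open>The factor independent of x in Cauchy-Schwarz for the form of \<open>a\<close>
    at \<open>\<zeta>\<close> and \<open>U (- x) v\<close>; the other factor is the function
    \<open>f\<close> integrated below.\<close>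
  define s where "s = 2 * (a \<zeta> \<bullet> \<zeta>)"
  have s: "s \<ge> 0" using cpt_posD(3)[OF a] by (simp add: s_def)
  have "(\<integral>\<^sup>+x. ennreal ((coef (a \<zeta>) v x)\<^sup>2) \<partial>\<mu>) \<le> ennreal ((s * t) * (norm v)\<^sup>2)" for v
  proof -
    define f where "f = (\<lambda>x. act U x a v \<bullet> v)"
    have cont: "continuous_on UNIV f" unfolding f_def by (rule continuous_inner_act[OF bop])
    have f_pos: "f x \<ge> 0" for x unfolding f_def inner_act by (rule cpt_posD(3)[OF a])
    have f_meas: "f \<in> borel_measurable \<mu>" unfolding f_def by (rule measurable_inner_act[OF bop])
    have "(\<integral>\<^sup>+x. ennreal (f x) * indicator K x \<partial>\<mu>) \<le> ennreal (T v \<bullet> v)" if K: "compact K" for K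
    proof -
      have "(\<integral>\<^sup>+x. ennreal (f x) * indicator K x \<partial>\<mu>) = (\<integral>\<^sup>+x. ennreal (indicator K x * f x) \<partial>\<mu>)"
        by (intro nn_integral_cong) (auto simp: indicator_def)
      also have "\<dots> = ennreal (\<integral>x. indicator K x * f x \<partial>\<mu>)"
        unfolding f_def
        by (intro nn_integral_eq_integral Bset_act_bound(1) bop indicator_in_Bset K)
           (use f_pos in \<open>auto simp: f_def\<close>)
      also have "\<dots> \<le> ennreal (T v \<bullet> v)"
        unfolding f_def by (intro ennreal_leI proper_elem_integral_le a T lim indicator_in_Bset K)
      finally show ?thesis .
    qed
    then have le: "(\<integral>\<^sup>+x. ennreal (f x) \<partial>\<mu>) \<le> ennreal (T v \<bullet> v)"
      by (rule left_haar_nn_integral_le[OF haar cont f_pos])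
    have "(coef (a \<zeta>) v x)\<^sup>2 \<le> s * f x" for x
      unfolding coef_def cip_U s_def f_def inner_act by (rule cpt_pos_cauchy_schwarz[OF a])
    then have "(\<integral>\<^sup>+x. ennreal ((coef (a \<zeta>) v x)\<^sup>2) \<partial>\<mu>) \<le> (\<integral>\<^sup>+x. ennreal s * ennreal (f x) \<partial>\<mu>)"
      using s f_pos by (intro nn_integral_mono) (simp add: ennreal_mult[symmetric] ennreal_leI)
    also have "\<dots> = ennreal s * (\<integral>\<^sup>+x. ennreal (f x) \<partial>\<mu>)"
      using f_meas by (intro nn_integral_cmult) measurable
    also have "\<dots> \<le> ennreal s * ennreal (T v \<bullet> v)" by (intro mult_left_mono le) simp
    also have "\<dots> \<le> ennreal s * ennreal (t * (norm v)\<^sup>2)"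
    proof (intro mult_left_mono ennreal_leI)
      have "T v \<bullet> v \<le> norm (T v) * norm v" by (rule norm_cauchy_schwarz)
      also have "\<dots> \<le> (norm v * t) * norm v" by (intro mult_right_mono t) simp
      finally show "T v \<bullet> v \<le> t * (norm v)\<^sup>2" by (simp add: power2_eq_square mult_ac)
    qed simp
    also have "\<dots> = ennreal ((s * t) * (norm v)\<^sup>2)"
      using s t(2) by (simp add: ennreal_mult[symmetric] mult.assoc)
    finally show ?thesis .
  qed
  moreover have "0 \<le> s * t" using s t(2) by simp
  ultimately show ?thesis unfolding U_bounded_iff by blast
qed

lemma proper_imp_square_integrable:
  assumes "alpha_proper \<mu> J U"
  shows "square_integrable \<mu> J U"
proof -
  have "\<xi> \<in> closure {\<xi>. U_bounded \<mu> J U \<xi>}" for \<xi>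
    unfolding closure_approachable
  proof (intro allI impI)
    fix e :: real assume "e > 0"
    show "\<exists>y\<in>{\<xi>. U_bounded \<mu> J U \<xi>}. dist y \<xi> < e"
    proof (cases "\<xi> = 0")
      case True
      then show ?thesis using U_bounded_zero \<open>e > 0\<close> by (intro bexI[of _ 0]) auto
    next
      case False
      let ?n = "norm \<xi>"
      have "e * ?n > 0" using False \<open>e > 0\<close> by simp
      \<comment> \<open>The tolerance \<open>e * ?n\<close> is matched to evaluation at
        \<open>\<xi>\<close>: the error there is below \<open>e * ?n\<close> times
        \<open>?n\<close>, and division by the square of \<open>?n\<close> leaves
        \<open>e\<close>.\<close>
      then obtain n :: nat and c b where b: "\<And>i. i < n \<Longrightarrow> alpha_proper_elem \<mu> J U (b i)"
        and near: "onorm (\<lambda>v. rank_one \<xi> \<xi> v - (\<Sum>i<n. csc J (c i) (b i v))) < e * ?n"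
        using assms cpt_rank_one unfolding alpha_proper_def by meson
      let ?F = "\<lambda>v. \<Sum>i<n. csc J (c i) (b i v)"
      have bopb: "bop J (b i)" if "i < n" for i
        using b[OF that] by (auto simp: alpha_proper_elem_def dest: cpt_posD(2))
      have bl: "bounded_linear (\<lambda>v. rank_one \<xi> \<xi> v - ?F v)"
        by (intro bounded_linear_sub bounded_linear_sum bopD(1) bop_rank_one bop_csc_bop bopb) auto
      define y where "y = (1 / ?n\<^sup>2) *\<^sub>R ?F \<xi>"
      have "U_bounded \<mu> J U (csc J (complex_of_real (1 / ?n\<^sup>2)) (?F \<xi>))"
        by (intro U_bounded_csc U_bounded_sum proper_elem_range_U_bounded b)
      then have "U_bounded \<mu> J U y" by (simp only: y_def csc_of_real)
      moreover have "norm (\<xi> - y) < e"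
      proof -
        have "rank_one \<xi> \<xi> \<xi> = ?n\<^sup>2 *\<^sub>R \<xi>" by (rule rank_one_self)
        then have "rank_one \<xi> \<xi> \<xi> - ?F \<xi> = ?n\<^sup>2 *\<^sub>R (\<xi> - y)"
          using False by (simp add: y_def scaleR_diff_right)
        then have "?n\<^sup>2 * norm (\<xi> - y) = norm (rank_one \<xi> \<xi> \<xi> - ?F \<xi>)" by simp
        also have "\<dots> \<le> onorm (\<lambda>v. rank_one \<xi> \<xi> v - ?F v) * ?n" by (rule onorm[OF bl])
        also have "\<dots> < (e * ?n) * ?n" using near False by (intro mult_strict_right_mono) auto
        finally have "?n\<^sup>2 * norm (\<xi> - y) < ?n\<^sup>2 * e" by (simp add: power2_eq_square mult_ac)
        then show ?thesis using False by simp
      qed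
      ultimately show ?thesis by (intro bexI[of _ y]) (auto simp: dist_norm norm_minus_commute)
    qed
  qed
  then show ?thesis unfolding square_integrable_def by blast
qed

subsection \<open>Square-integrability implies properness\<close>

lemma inner_act_rank_one:
  "act U x (rank_one \<xi> \<xi>) v \<bullet> w = Re (cip J v (U x \<xi>) * cip J (U x \<xi>) w)"
proof -
  have "act U x (rank_one \<xi> \<xi>) v = csc J (cip J v (U x \<xi>)) (U x \<xi>)"
    by (simp add: act_apply rank_one_def bop_csc[OF bop_U] cip_U)
  then show ?thesis by (metis Re_cip cip_csc_left)
qed

lemma inner_act_rank_one_sym:
  "act U x (rank_one \<xi> \<xi>) v \<bullet> w = act U x (rank_one \<xi> \<xi>) w \<bullet> v"
proof -
  have "cip J w (U x \<xi>) * cip J (U x \<xi>) v = cnj (cip J v (U x \<xi>) * cip J (U x \<xi>) w)"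
    by (simp add: cnj_cip mult.commute)
  then show ?thesis by (simp only: inner_act_rank_one complex_cnj(1)[symmetric] cnj.simps)
qed

lemma inner_act_rank_one_self: "act U x (rank_one \<xi> \<xi>) v \<bullet> v = (coef \<xi> v x)\<^sup>2"
proof -
  have "cip J v (U x \<xi>) * cip J (U x \<xi>) v = complex_of_real ((coef \<xi> v x)\<^sup>2)"
    unfolding coef_def by (metis cnj_cip complex_norm_square mult.commute)
  then show ?thesis by (simp add: inner_act_rank_one)
qed

text \<open>The arithmetic-geometric mean inequality replaces a product of two coefficients by their
  squares, giving an integrable majorant when \<open>\<xi>\<close> is U-bounded.\<close>

lemma abs_inner_act_rank_one_le:
  "\<bar>act U x (rank_one \<xi> \<xi>) v \<bullet> w\<bar> \<le> ((coef \<xi> v x)\<^sup>2 + (coef \<xi> w x)\<^sup>2) / 2"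
proof -
  have "\<bar>act U x (rank_one \<xi> \<xi>) v \<bullet> w\<bar> \<le> cmod (cip J v (U x \<xi>) * cip J (U x \<xi>) w)"
    unfolding inner_act_rank_one by (rule abs_Re_le_cmod)
  also have "\<dots> = coef \<xi> v x * coef \<xi> w x"
    by (simp add: coef_def norm_mult cmod_cip_commute[of v])
  also have "\<dots> \<le> ((coef \<xi> v x)\<^sup>2 + (coef \<xi> w x)\<^sup>2) / 2"
    using zero_le_power2[of "coef \<xi> v x - coef \<xi> w x"] by (simp add: power2_eq_square algebra_simps)
  finally show ?thesis .
qed

lemma U_bounded_coef_integrable:
  assumes "U_bounded \<mu> J U \<xi>"
  shows "\<exists>C>0. \<forall>v. integrable \<mu> (\<lambda>x. (coef \<xi> v x)\<^sup>2) \<and> (\<integral>x. (coef \<xi> v x)\<^sup>2 \<partial>\<mu>) \<le> C * (norm v)\<^sup>2"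
proof -
  obtain C where C: "0 \<le> C"
    "\<And>v. (\<integral>\<^sup>+x. ennreal ((coef \<xi> v x)\<^sup>2) \<partial>\<mu>) \<le> ennreal (C * (norm v)\<^sup>2)"
    using assms by (auto simp: U_bounded_iff)
  note [measurable] = measurable_coef
  have int: "integrable \<mu> (\<lambda>x. (coef \<xi> v x)\<^sup>2)" for v
    by (rule integrableI_nonneg) (use C(2)[of v] in \<open>auto intro: le_less_trans\<close>)
  have "(\<integral>x. (coef \<xi> v x)\<^sup>2 \<partial>\<mu>) \<le> C * (norm v)\<^sup>2" for v
    using C(2)[of v] C(1) by (subst (asm) nn_integral_eq_integral[OF int]) (auto simp: ennreal_le_iff)
  \<comment> \<open>The constant is raised by 1 to make it strictly positive, since it is later
    divided by.\<close>
  then have "(\<integral>x. (coef \<xi> v x)\<^sup>2 \<partial>\<mu>) \<le> (C + 1) * (norm v)\<^sup>2" for v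
    by (rule order_trans) (simp add: mult_right_mono)
  with int C(1) show ?thesis by (intro exI[of _ "C + 1"]) auto
qed

text \<open>The limit is the weak integral with weight 1. The differences \<open>D l\<close> are
  negative operators of norm at most C that vanish strongly along the net, which is the input for
  \<open>strictly_small_of_small_on_finite\<close>.\<close>

lemma rank_one_proper:
  assumes "U_bounded \<mu> J U \<xi>"
  shows "alpha_proper_elem \<mu> J U (rank_one \<xi> \<xi>)"
proof -
  let ?a = "rank_one \<xi> \<xi>"
  obtain C where C: "C > 0" and int: "\<And>v. integrable \<mu> (\<lambda>x. (coef \<xi> v x)\<^sup>2)"
    and int_le: "\<And>v. (\<integral>x. (coef \<xi> v x)\<^sup>2 \<partial>\<mu>) \<le> C * (norm v)\<^sup>2"
    using U_bounded_coef_integrable[OF assms] by blast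
  have bop: "bop J ?a" by (rule bop_rank_one)
  note [measurable] = measurable_inner_act[OF bop]
  define Q where "Q = (\<lambda>g v w. \<integral>x. g x * (act U x ?a v \<bullet> w) \<partial>\<mu>)"
  \<comment> \<open>All weights with values in [0,1] are treated at once, so that 1, l and 1 - l
    share the same C.\<close>
  have Q_int: "integrable \<mu> (\<lambda>x. g x * (act U x ?a v \<bullet> w))"
    and Q_op: "\<exists>T. bop J T \<and> (\<forall>v w. T v \<bullet> w = Q g v w) \<and> (\<forall>v. norm (T v) \<le> C * norm v)"
    if [measurable]: "g \<in> borel_measurable \<mu>" and g: "\<And>x. 0 \<le> g x \<and> g x \<le> 1" for g v w
  proof -
    have pt: "\<bar>g x * (act U x ?a v \<bullet> w)\<bar> \<le> ((coef \<xi> v x)\<^sup>2 + (coef \<xi> w x)\<^sup>2) / 2" for x v w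
    proof -
      have "\<bar>g x\<bar> * \<bar>act U x ?a v \<bullet> w\<bar> \<le> 1 * \<bar>act U x ?a v \<bullet> w\<bar>"
        using g[of x] by (intro mult_right_mono) auto
      with abs_inner_act_rank_one_le[of x \<xi> v w] show ?thesis by (simp add: abs_mult)
    qed
    have dom: "integrable \<mu> (\<lambda>x. ((coef \<xi> v x)\<^sup>2 + (coef \<xi> w x)\<^sup>2) / 2)" for v w
      by (intro integrable_divide Bochner_Integration.integrable_add int)
    show Q_int: "integrable \<mu> (\<lambda>x. g x * (act U x ?a v \<bullet> w))" for v w
    proof (rule Bochner_Integration.integrable_bound[OF dom[of v w]])
      show "AE x in \<mu>. norm (g x * (act U x ?a v \<bullet> w)) \<le> norm (((coef \<xi> v x)\<^sup>2 + (coef \<xi> w x)\<^sup>2) / 2)"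
        using pt by (intro AE_I2) (simp only: real_norm_def, meson abs_ge_self order_trans)
    qed measurable
    show "\<exists>T. bop J T \<and> (\<forall>v w. T v \<bullet> w = Q g v w) \<and> (\<forall>v. norm (T v) \<le> C * norm v)"
      unfolding Q_def
    proof (rule weak_integral_operator[OF bop Q_int])
      fix v w :: 'h assume vw: "norm v \<le> 1" "norm w \<le> 1"
      have one: "(\<integral>x. (coef \<xi> u x)\<^sup>2 \<partial>\<mu>) \<le> C" if "norm u \<le> 1" for u
      proof -
        have "C * (norm u)\<^sup>2 \<le> C * 1"
          using that C by (intro mult_left_mono) (auto simp: power_le_one)
        with int_le[of u] show ?thesis by simp
      qed
      have "\<bar>\<integral>x. g x * (act U x ?a v \<bullet> w) \<partial>\<mu>\<bar> \<le> (\<integral>x. \<bar>g x * (act U x ?a v \<bullet> w)\<bar> \<partial>\<mu>)"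
        by (rule integral_abs_bound)
      also have "\<dots> \<le> (\<integral>x. ((coef \<xi> v x)\<^sup>2 + (coef \<xi> w x)\<^sup>2) / 2 \<partial>\<mu>)"
        by (intro integral_mono integrable_abs Q_int dom pt)
      also have "\<dots> = ((\<integral>x. (coef \<xi> v x)\<^sup>2 \<partial>\<mu>) + (\<integral>x. (coef \<xi> w x)\<^sup>2 \<partial>\<mu>)) / 2"
        by (simp add: Bochner_Integration.integral_add[OF int int])
      also have "\<dots> \<le> C" using one[OF vw(1)] one[OF vw(2)] by simp
      finally show "\<bar>\<integral>x. g x * (act U x ?a v \<bullet> w) \<partial>\<mu>\<bar> \<le> C" .
    qed
  qed
  have "(\<lambda>x. 1) \<in> borel_measurable \<mu>" by simp
  from Q_op[OF this] obtain T where T: "bop J T" "\<And>v w. T v \<bullet> w = Q (\<lambda>x. 1) v w" by auto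
  define D where "D = (\<lambda>l v. p_op \<mu> J U l ?a v - T v)"
  have D_inner: "- D l v \<bullet> w = Q (\<lambda>x. 1 - l x) v w" if l: "l \<in> Bset \<mu>" for l v w
  proof -
    have "- D l v \<bullet> w = Q (\<lambda>x. 1) v w - Q l v w"
      by (simp add: D_def inner_diff_left T(2) p_op(2)[OF bop l]) (simp add: Q_def)
    also have "\<dots> = (\<integral>x. 1 * (act U x ?a v \<bullet> w) - l x * (act U x ?a v \<bullet> w) \<partial>\<mu>)"
      unfolding Q_def
      by (intro Bochner_Integration.integral_diff[symmetric] Q_int) (use BsetD[OF l] in auto)
    also have "\<dots> = Q (\<lambda>x. 1 - l x) v w" by (simp add: Q_def left_diff_distrib)
    finally show ?thesis .
  qed
  have Q_sym: "Q g v w = Q g w v" for g v w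
    unfolding Q_def by (simp only: inner_act_rank_one_sym[of _ \<xi> v w])
  have bop_D: "bop J (D l)" if "l \<in> Bset \<mu>" for l
    unfolding D_def by (intro bop_diff p_op(1) bop that T)
  have D_sym: "D l v \<bullet> w = D l w \<bullet> v" if "l \<in> Bset \<mu>" for l v w
    using D_inner[OF that, of v w] D_inner[OF that, of w v] Q_sym[of _ v w] by simp
  have D_norm: "norm (D l v) \<le> C * norm v" if l: "l \<in> Bset \<mu>" for l v
  proof -
    have "(\<lambda>x. 1 - l x) \<in> borel_measurable \<mu>" using BsetD(1)[OF l] by measurable
    from Q_op[OF this] obtain S where S: "\<And>v w. S v \<bullet> w = Q (\<lambda>x. 1 - l x) v w"
      "\<And>v. norm (S v) \<le> C * norm v" using BsetD(2,3)[OF l] by auto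
    have "- D l v = S v"
      by (rule vector_eq_rdot[THEN iffD1]) (simp only: D_inner[OF l] S(1) simp_thms)
    then have "norm (D l v) = norm (S v)" by (metis norm_minus_cancel)
    with S(2)[of v] show ?thesis by simp
  qed
  have tail: "\<exists>K. compact K \<and> (\<forall>l\<in>Bset \<mu>. indicator K \<le> l \<longrightarrow> norm (D l v) < d)"
    if "d > 0" for v d
  proof -
    have "continuous_on UNIV (\<lambda>x. (coef \<xi> v x)\<^sup>2)" by (intro continuous_intros continuous_coef)
    \<comment> \<open>The threshold is chosen because the squared norm of \<open>D l v\<close> is at
      most C times the quadratic form of \<open>- D l\<close> at \<open>v\<close>.\<close>
    from left_haar_compact_tail[OF haar this _ int, of "d\<^sup>2 / C"] obtain K where K: "compact K"
      "(\<integral>x. indicator (- K) x * (coef \<xi> v x)\<^sup>2 \<partial>\<mu>) < d\<^sup>2 / C"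
      using C \<open>d > 0\<close> by auto
    have "norm (D l v) < d" if l: "l \<in> Bset \<mu>" and le: "indicator K \<le> l" for l
    proof -
      have [measurable]: "- K \<in> sets \<mu>"
        using compact_sets[OF K(1)] left_haar_space[OF haar] by (metis Compl_eq_Diff_UNIV sets.compl_sets)
      have "- D l v \<bullet> v \<le> (\<integral>x. indicator (- K) x * (coef \<xi> v x)\<^sup>2 \<partial>\<mu>)"
        unfolding D_inner[OF l] Q_def
      proof (rule integral_mono)
        show "integrable \<mu> (\<lambda>x. (1 - l x) * (act U x ?a v \<bullet> v))"
          using BsetD[OF l] by (intro Q_int) auto
        show "integrable \<mu> (\<lambda>x. indicator (- K) x * (coef \<xi> v x)\<^sup>2)"
          using integrable_mult_indicator[OF _ int, of "- K" v] by simp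
        fix x
        \<comment> \<open>On K the weight vanishes or is negative because \<open>l\<close> dominates
          the indicator; off K it is at most 1.\<close>
        have "1 - l x \<le> indicator (- K) x"
          using le BsetD(2)[OF l, of x] by (auto simp: le_fun_def indicator_def dest: spec[of _ x])
        then show "(1 - l x) * (act U x ?a v \<bullet> v) \<le> indicator (- K) x * (coef \<xi> v x)\<^sup>2"
          unfolding inner_act_rank_one_self by (intro mult_right_mono) auto
      qed
      also note K(2)
      finally have small: "- D l v \<bullet> v < d\<^sup>2 / C" .
      have "(norm (- D l v))\<^sup>2 \<le> C * (- D l v \<bullet> v)"
      proof (rule psd_norm_square_le)
        show "linear (\<lambda>v. - D l v)"
          by (intro bounded_linear.linear bounded_linear_minus bopD(1)[OF bop_D[OF l]])
        show "- D l v \<bullet> w = - D l w \<bullet> v" for v w using D_sym[OF l, of v w] by simp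
        show "norm (- D l v) \<le> C * norm v" for v using D_norm[OF l] by simp
        show "0 \<le> - D l v \<bullet> v" for v
          unfolding D_inner[OF l] Q_def inner_act_rank_one_self
          using BsetD[OF l] by (intro Bochner_Integration.integral_nonneg mult_nonneg_nonneg) auto
      qed
      also have "\<dots> < C * (d\<^sup>2 / C)" using small C by (intro mult_strict_left_mono)
      also have "\<dots> = d\<^sup>2" using C by simp
      finally show ?thesis using \<open>d > 0\<close> by (auto dest: power_less_imp_less_base)
    qed
    with K(1) show ?thesis by blast
  qed
  have strict: "\<exists>l0\<in>Bset \<mu>. \<forall>l\<in>Bset \<mu>. l0 \<le> l \<longrightarrow> onorm (D l \<circ> b) < e \<and> onorm (b \<circ> D l) < e"
    if b: "cpt J b" and e: "e > 0" for b e
  proof -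
    from strictly_small_of_small_on_finite[OF b e C]
    obtain Y d where Y: "finite Y" "d > 0" and small:
      "\<forall>D. bounded_linear D \<and> (\<forall>v w. D v \<bullet> w = D w \<bullet> v) \<and> (\<forall>v. norm (D v) \<le> C * norm v) \<and>
        (\<forall>y\<in>Y. norm (D y) < d) \<longrightarrow> onorm (D \<circ> b) < e \<and> onorm (b \<circ> D) < e"
      by (elim exE conjE)
    obtain K where K: "\<And>y. compact (K y)"
      "\<And>y l. l \<in> Bset \<mu> \<Longrightarrow> indicator (K y) \<le> l \<Longrightarrow> norm (D l y) < d"
      using tail[OF Y(2)] by metis
    \<comment> \<open>The indicator of this union, compact because Y is finite, is one threshold in
      the net that serves all test vectors.\<close>
    let ?K = "\<Union>y\<in>Y. K y"
    have "compact ?K" using Y(1) K(1) by (intro compact_UN) auto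
    moreover have "onorm (D l \<circ> b) < e \<and> onorm (b \<circ> D l) < e"
      if l: "l \<in> Bset \<mu>" and le: "indicator ?K \<le> l" for l
    proof (rule small[THEN spec, THEN mp], intro conjI allI ballI)
      fix y assume "y \<in> Y"
      then have "indicator (K y) \<le> (indicator ?K :: 'g \<Rightarrow> real)"
        by (auto simp: le_fun_def indicator_def)
      then show "norm (D l y) < d" using le by (intro K(2)[OF l]) (rule order_trans)
    qed (intro bopD(1) bop_D D_sym D_norm l)+
    ultimately show ?thesis using indicator_in_Bset by (intro bexI[of _ "indicator ?K"]) auto
  qed
  show ?thesis
    unfolding alpha_proper_elem_def
  proof (rule conjI[OF cpt_pos_rank_one], rule exI[of _ T], rule conjI[OF T(1)], intro allI impI)
    fix b :: "'h \<Rightarrow> 'h" and e :: real assume "cpt J b" "e > 0"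
    then show "\<exists>l0\<in>Bset \<mu>. \<forall>l\<in>Bset \<mu>. l0 \<le> l \<longrightarrow>
        onorm ((\<lambda>v. p_op \<mu> J U l ?a v - T v) \<circ> b) < e \<and> onorm (b \<circ> (\<lambda>v. p_op \<mu> J U l ?a v - T v)) < e"
      by (rule strict[unfolded D_def])
  qed
qed

lemma square_integrable_imp_proper:
  assumes "square_integrable \<mu> J U"
  shows "alpha_proper \<mu> J U"
  unfolding alpha_proper_def
proof (intro allI impI)
  fix a :: "'h \<Rightarrow> 'h" and e :: real assume a: "cpt J a" and e: "e > 0"
  let ?D = "{\<xi>. U_bounded \<mu> J U \<xi>}"
  have "closure ?D = UNIV" using assms by (simp add: square_integrable_def)
  moreover have "e / 2 > 0" using e by simp
  ultimately obtain F where F: "F \<in> csc_span ((\<lambda>x. rank_one x x) ` ?D)"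
    "\<And>v. norm (a v - F v) \<le> (e / 2) * norm v"
    using cpt_approx_by_span[OF a, of "e / 2" ?D]
    by (auto simp: U_bounded_add U_bounded_diff U_bounded_J)
  then obtain n c b where nb: "\<forall>i<(n::nat). b i \<in> (\<lambda>x. rank_one x x) ` ?D"
    "F = (\<lambda>v. \<Sum>i<n. csc J (c i) (b i v))" by (auto simp: csc_span_def)
  have "onorm (\<lambda>v. a v - F v) \<le> e / 2" using e by (intro onorm_bound F) auto
  then have "onorm (\<lambda>v. a v - F v) < e" using e by simp
  moreover have "alpha_proper_elem \<mu> J U (b i)" if "i < n" for i
  proof -
    obtain x where "U_bounded \<mu> J U x" "b i = rank_one x x" using nb(1) \<open>i < n\<close> by auto
    then show ?thesis by (simp add: rank_one_proper)
  qed
  ultimately show "\<exists>(n::nat) c b. (\<forall>i<n. alpha_proper_elem \<mu> J U (b i)) \<and>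
      onorm (\<lambda>v. a v - (\<Sum>i<n. csc J (c i) (b i v))) < e"
    unfolding nb(2) by blast
qed

end

theorem theorem7p9:
  fixes \<mu> :: "'g::{t2_space, group_add} measure"
    and J :: "'h::{real_inner, complete_space} \<Rightarrow> 'h"
    and U :: "'g \<Rightarrow> 'h \<Rightarrow> 'h"
  assumes "lc_group TYPE('g)"
    and "left_haar \<mu>"
    and "complex_structure J"
    and "sc_unitary_rep J U"
  shows "alpha_proper \<mu> J U \<longleftrightarrow> square_integrable \<mu> J U"
proof -
  interpret haar_rep J \<mu> U
    by unfold_locales (use assms in auto)
  show ?thesis
    using proper_imp_square_integrable square_integrable_imp_proper by blast
qed

end
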